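(* Let $U$, $V$ be complex vector spaces of dimension $3$ and $n$, let $r$ be even, and let $X\simeq\mathbf{P}(U)\times\mathbf{P}(V)\subset\mathbf{P}(U\otimes S^2V)$ be embedded by $\mathcal{O}(1,2)$. Let $f\in\sigma_{n+(r/2)}(X)$ be general and let $E=E(f)\in M_{sp}(r,n)$ be the corresponding bundle on $\mathbf{P}(U)$. Then $h^0(E(1))\ge r/2$.
   Context: $\mathbf{P}(W)$ is the projective space of lines in $W$. $X$ is the variety of tensors $u\otimes v^2$. $\sigma_k(X)$ is the Zariski closure of the union of the linear spans of $k$ points of $X$. A vector bundle $E$ is symplectic if there is an isomorphism $\alpha\colon E\to E^\vee$ with $\alpha^t=-\alpha$. $M_{sp}(r,n)$ is the moduli space of stable symplectic bundles of rank $r$ on $\mathbf{P}(U)=\mathbf{P}^2$ with $c_2=n$. An element $f\in U\otimes S^2V\subset U\otimes V\otimes V=\operatorname{Hom}(V^\vee\otimes\Omega^1(2),V\otimes\mathcal{O}(1))$ defines a bundle map on $\mathbf{P}(U)$. When this map is surjective and $\operatorname{rank}H^0(f)=2n+r$ (where $H^0(f)\colon V^\vee\otimes H^0(\Omega^1(2))\to V\otimes H^0(\mathcal{O}(1))$), $E(f)$ is the cohomology bundle $\operatorname{Ker}f/\operatorname{Im}g$ of the Barth monad $I\otimes\mathcal{O}\xrightarrow{g}V^\vee\otimes\Omega^1(2)\xrightarrow{f}V\otimes\mathcal{O}(1)$, with $I=\ker H^0(f)$ of dimension $n-r$; it is a symplectic bundle of rank $r$ with $c_2=n$ and $H^0(E(f))=0$.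 *)

theory Defs
  imports "HOL-Analysis.Analysis" "HOL-Library.Extended_Nat" "HOL-Computational_Algebra.Polynomial"
begin

text \<open>
  Conventions. A complex vector space with a basis indexed by \<open>'m\<close> is \<open>complex ^ 'm\<close>; so
  \<open>U = complex ^ 3\<close>, \<open>V = complex ^ 'n\<close>, and \<open>U \<otimes> V \<otimes> V = complex ^ (3 \<times> 'n \<times> 'n)\<close>. A point of the
  projective space of lines in \<open>W\<close> is represented by any nonzero vector on the line, and a subset
  of the projective space by the (scaling-invariant) set of all representatives of its points.
\<close>

section \<open>Zariski topology\<close>

text \<open>Homogeneous polynomial functions of a given degree (the zero function has every degree).\<close>

inductive form :: "nat \<Rightarrow> (complex ^ 'm::finite \<Rightarrow> complex) \<Rightarrow> bool" where
  const: "form 0 (\<lambda>_. c)"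
| coord: "form d p \<Longrightarrow> form (Suc d) (\<lambda>x. x $ i * p x)"
| add: "form d p \<Longrightarrow> form d q \<Longrightarrow> form d (\<lambda>x. p x + q x)"

definition zclosed :: "(complex ^ 'm::finite) set \<Rightarrow> bool" where
  "zclosed Z \<longleftrightarrow> (\<exists>P. (\<forall>p\<in>P. \<exists>d. form d p) \<and> Z = {x. x \<noteq> 0 \<and> (\<forall>p\<in>P. p x = 0)})"

definition zopen :: "(complex ^ 'm::finite) set \<Rightarrow> bool" where
  "zopen D \<longleftrightarrow> (\<exists>Z. zclosed Z \<and> D = {x. x \<noteq> 0} - Z)"

abbreviation zclosure :: "(complex ^ 'm::finite) set \<Rightarrow> (complex ^ 'm) set" where
  "zclosure S \<equiv> zclosed hull S"

text \<open>\<open>Q\<close> holds for the general point of \<open>S\<close>: it holds on a dense relatively open subset of \<open>S\<close>.\<close>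

definition generically :: "(complex ^ 'm::finite) set \<Rightarrow> (complex ^ 'm \<Rightarrow> bool) \<Rightarrow> bool" where
  "generically S Q \<longleftrightarrow> (\<exists>Z. zclosed Z \<and> S \<subseteq> zclosure (S - Z) \<and> (\<forall>f \<in> S - Z. Q f))"

section \<open>Secant varieties\<close>

definition segre_veronese :: "(complex ^ (3 \<times> 'n \<times> 'n::finite)) set" where
  "segre_veronese =
    {(\<chi> j. case j of (i, a, b) \<Rightarrow> u $ i * v $ a * v $ b) | (u :: complex ^ 3) (v :: complex ^ 'n). u \<noteq> 0 \<and> v \<noteq> 0}"

text \<open>
  The closure may be taken among all tensors: the symmetric ones form a linear, hence closed,
  subspace.
\<close>

definition secant :: "nat \<Rightarrow> (complex ^ (3 \<times> 'n \<times> 'n::finite)) set" where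
  "secant k =
    zclosure (\<Union> {vec.span T | T. T \<subseteq> segre_veronese \<and> finite T \<and> card T = k} - {0})"

section \<open>Vector bundles on the plane\<close>

text \<open>
  \<open>regular D e h\<close>: \<open>h\<close> is a section of \<open>\<O>(e)\<close> over \<open>D\<close>, i.e. a function on the cone over \<open>D\<close>
  that is locally a quotient of forms whose degrees differ by \<open>e\<close>.
\<close>

definition regular :: "(complex ^ 3) set \<Rightarrow> int \<Rightarrow> (complex ^ 3 \<Rightarrow> complex) \<Rightarrow> bool" where
  "regular D e h \<longleftrightarrow> (\<forall>x\<in>D. \<exists>i j p q. form i p \<and> form j q \<and> int i - int j = e \<and> q x \<noteq> 0 \<and>
      (\<forall>y\<in>D. q y \<noteq> 0 \<longrightarrow> h y = p y / q y))"

text \<open>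
  A vector bundle given as a subquotient of \<open>complex ^ 'm \<otimes> \<O>(twist)\<close>: its fibre at \<open>x\<close> is
  \<open>upper x / lower x\<close>, and its sections are homogeneous of degree \<open>twist\<close> in \<open>x\<close>.
\<close>

record ('m::finite) vbundle =
  upper :: "complex ^ 3 \<Rightarrow> (complex ^ 'm) set"
  lower :: "complex ^ 3 \<Rightarrow> (complex ^ 'm) set"
  twist :: int

text \<open>
  A section of \<open>E(d)\<close> over \<open>D\<close> is a map sending \<open>x \<in> D\<close> to a coset in \<open>upper x / lower x\<close> that
  locally has a regular lift to \<open>upper\<close>. It is represented here by an arbitrary choice \<open>k\<close>
  of elements of these cosets; two such choices give the same section iff their difference lies
  in \<open>null_sections\<close>.
\<close>

definition sections :: "(complex ^ 3) set \<Rightarrow> 'm::finite vbundle \<Rightarrow> int \<Rightarrow>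
    (complex ^ 3 \<Rightarrow> complex ^ 'm) set" where
  "sections D E d = {k. \<forall>x\<in>D. \<exists>D' k'. zopen D' \<and> x \<in> D' \<and> D' \<subseteq> D \<and>
      (\<forall>i. regular D' (twist E + d) (\<lambda>y. k' y $ i)) \<and>
      (\<forall>y\<in>D'. k' y \<in> upper E y \<and> k y - k' y \<in> lower E y)}"

definition null_sections :: "(complex ^ 3) set \<Rightarrow> 'm::finite vbundle \<Rightarrow>
    (complex ^ 3 \<Rightarrow> complex ^ 'm) set" where
  "null_sections D E = {k. \<forall>x\<in>D. k x \<in> lower E x}"

abbreviation plane :: "(complex ^ 3) set" where
  "plane \<equiv> {x. x \<noteq> 0}"

text \<open>Dimension of the image of the space \<open>S\<close> in the quotient by \<open>N\<close>.\<close>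

definition dim_mod :: "(complex ^ 3 \<Rightarrow> complex ^ 'm::finite) set \<Rightarrow>
    (complex ^ 3 \<Rightarrow> complex ^ 'm) set \<Rightarrow> enat" where
  "dim_mod S N = (SUP B \<in> {B. finite B \<and> B \<subseteq> S \<and>
      (\<forall>c. (\<lambda>x. \<Sum>b\<in>B. c b *s b x) \<in> N \<longrightarrow> (\<forall>b\<in>B. c b = 0))}. enat (card B))"

text \<open>\<open>h0 E d\<close> is \<open>h\<^sup>0(E(d))\<close>.\<close>

definition h0 :: "'m::finite vbundle \<Rightarrow> int \<Rightarrow> enat" where
  "h0 E d = dim_mod (sections plane E d) (null_sections plane E)"

section \<open>Stability\<close>

text \<open>
  \<open>F D\<close> consists of all representatives of the sections over \<open>D\<close> of a subsheaf of
  \<open>\<O>\<close>-modules of \<open>E\<close>. A subsheaf of the coherent sheaf \<open>E\<close> is coherent iff it is of finite type,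
  which is the second conjunct.
\<close>

definition coherent_subsheaf :: "'m::finite vbundle \<Rightarrow>
    ((complex ^ 3) set \<Rightarrow> (complex ^ 3 \<Rightarrow> complex ^ 'm) set) \<Rightarrow> bool" where
  "coherent_subsheaf E F \<longleftrightarrow>
    (\<forall>D. zopen D \<longrightarrow>
      F D \<subseteq> sections D E 0 \<and>
      null_sections D E \<subseteq> F D \<and>
      (\<forall>s\<in>F D. \<forall>t\<in>F D. (\<lambda>x. s x + t x) \<in> F D) \<and>
      (\<forall>h. \<forall>s\<in>F D. regular D 0 h \<longrightarrow> (\<lambda>x. h x *s s x) \<in> F D) \<and>
      (\<forall>D'. zopen D' \<and> D' \<subseteq> D \<longrightarrow> F D \<subseteq> F D') \<and>
      (\<forall>s. (\<forall>x\<in>D. \<exists>D'. zopen D' \<and> x \<in> D' \<and> D' \<subseteq> D \<and> s \<in> F D') \<longrightarrow> s \<in> F D)) \<and>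
    (\<forall>x\<in>plane. \<exists>D G. zopen D \<and> x \<in> D \<and> finite G \<and> G \<subseteq> F D \<and>
      (\<forall>D' s. zopen D' \<and> D' \<subseteq> D \<and> s \<in> F D' \<longrightarrow>
        (\<forall>y\<in>D'. \<exists>D'' c. zopen D'' \<and> y \<in> D'' \<and> D'' \<subseteq> D' \<and> (\<forall>g\<in>G. regular D'' 0 (c g)) \<and>
          (\<forall>z\<in>D''. s z - (\<Sum>g\<in>G. c g z *s g z) \<in> lower E z))))"

text \<open>Global sections of \<open>F(d)\<close>; here \<open>t\<close> is a local generator of \<open>\<O>(-d)\<close>.\<close>

definition subsheaf_sections ::
  "((complex ^ 3) set \<Rightarrow> (complex ^ 3 \<Rightarrow> complex ^ 'm::finite) set) \<Rightarrow> int \<Rightarrow>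
    (complex ^ 3 \<Rightarrow> complex ^ 'm) set" where
  "subsheaf_sections F d = {k. \<forall>x\<in>plane. \<exists>D t. zopen D \<and> x \<in> D \<and> regular D (- d) t \<and>
      (\<forall>y\<in>D. t y \<noteq> 0) \<and> (\<lambda>y. t y *s k y) \<in> F D}"

text \<open>
  The Hilbert polynomial of a coherent sheaf \<open>F\<close>, from \<open>h d = h\<^sup>0(F(d))\<close>, which is \<open>\<chi>(F(d))\<close> for
  large \<open>d\<close>.
\<close>

definition hilbert_poly :: "(int \<Rightarrow> enat) \<Rightarrow> real poly \<Rightarrow> bool" where
  "hilbert_poly h P \<longleftrightarrow>
    (\<forall>\<^sub>F d in sequentially. \<exists>m. h (int d) = enat m \<and> poly P (real d) = real m)"

text \<open>
  Rank, \<open>c\<^sub>1\<close> and \<open>c\<^sub>2\<close> of a coherent sheaf on the plane from its Hilbert polynomial \<open>P\<close>, by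
  Riemann-Roch: \<open>P(t) = rk (t + 1) (t + 2) / 2 + c\<^sub>1 t + 3 c\<^sub>1 / 2 + c\<^sub>1\<^sup>2 / 2 - c\<^sub>2\<close>.
\<close>

definition hp_rank :: "real poly \<Rightarrow> real" where
  "hp_rank P = 2 * coeff P 2"

definition hp_c1 :: "real poly \<Rightarrow> real" where
  "hp_c1 P = coeff P 1 - 3 / 2 * hp_rank P"

definition hp_c2 :: "real poly \<Rightarrow> real" where
  "hp_c2 P = hp_rank P + 3 / 2 * hp_c1 P + (hp_c1 P)\<^sup>2 / 2 - coeff P 0"

text \<open>Slope stability (Mumford-Takemoto).\<close>

definition stable :: "'m::finite vbundle \<Rightarrow> bool" where
  "stable E \<longleftrightarrow> (\<forall>F P Q. coherent_subsheaf E F \<and>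
      hilbert_poly (\<lambda>d. dim_mod (subsheaf_sections F d) (null_sections plane E)) P \<and>
      hilbert_poly (h0 E) Q \<and>
      0 < hp_rank P \<and> hp_rank P < hp_rank Q \<longrightarrow>
      hp_c1 P / hp_rank P < hp_c1 Q / hp_rank Q)"

section \<open>Symplectic bundles\<close>

text \<open>
  An isomorphism from \<open>E\<close> to its dual with transpose equal to its negative is a regular family of
  skew forms \<open>\<beta> x\<close> on \<open>upper x\<close> with radical \<open>lower x\<close>. Pairing two sections of degree
  \<open>twist\<close> has to give a function of degree 0, so the local matrices have degree \<open>-2 twist\<close>.
\<close>

definition symplectic :: "'m::finite vbundle \<Rightarrow> bool" where
  "symplectic E \<longleftrightarrow> (\<exists>\<beta> :: complex ^ 3 \<Rightarrow> complex ^ 'm \<Rightarrow> complex ^ 'm \<Rightarrow> complex.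
    (\<forall>x\<in>plane. \<forall>v\<in>upper E x. \<forall>w\<in>upper E x. \<beta> x v w = - \<beta> x w v) \<and>
    (\<forall>x\<in>plane. {v \<in> upper E x. \<forall>w\<in>upper E x. \<beta> x v w = 0} = lower E x) \<and>
    (\<forall>x\<in>plane. \<exists>D A. zopen D \<and> x \<in> D \<and>
      (\<forall>i j. regular D (- 2 * twist E) (\<lambda>y. A y i j)) \<and>
      (\<forall>y\<in>D. \<forall>v\<in>upper E y. \<forall>w\<in>upper E y.
        \<beta> y v w = (\<Sum>i\<in>UNIV. \<Sum>j\<in>UNIV. v $ i * A y i j * w $ j))))"

definition moduli_sp :: "nat \<Rightarrow> nat \<Rightarrow> 'm::finite vbundle \<Rightarrow> bool" where
  "moduli_sp r n E \<longleftrightarrow> stable E \<and> symplectic E \<and>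
    (\<forall>x\<in>plane. vec.dim (upper E x) = vec.dim (lower E x) + r) \<and>
    (\<exists>P. hilbert_poly (h0 E) P \<and> hp_c2 P = real n)"

section \<open>The Barth monad\<close>

text \<open>
  By the dual Euler sequence, \<open>\<Omega>\<^sup>1(2) \<subseteq> U\<^sup>\<or> \<otimes> \<O>(1)\<close> has as fibre at \<open>x\<close> the linear forms on \<open>U\<close>
  that vanish at \<open>x\<close>. The coordinates of \<open>V\<^sup>\<or> \<otimes> U\<^sup>\<or>\<close> are indexed by \<open>'n \<times> 3\<close>.
\<close>

definition V_Omega2 :: "('n::finite \<times> 3) vbundle" where
  "V_Omega2 = \<lparr>upper = \<lambda>x. {w. \<forall>a. (\<Sum>i\<in>UNIV. w $ (a, i) * x $ i) = 0},
               lower = \<lambda>_. {0}, twist = 1\<rparr>"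

definition V_O1 :: "'n::finite vbundle" where
  "V_O1 = \<lparr>upper = \<lambda>_. UNIV, lower = \<lambda>_. {0}, twist = 1\<rparr>"

text \<open>The bundle map \<open>V\<^sup>\<or> \<otimes> \<Omega>\<^sup>1(2) \<rightarrow> V \<otimes> \<O>(1)\<close> defined by \<open>f\<close> is \<open>contract f\<close> on each fibre.\<close>

definition contract :: "complex ^ (3 \<times> 'n \<times> 'n) \<Rightarrow> complex ^ ('n \<times> 3) \<Rightarrow> complex ^ 'n::finite" where
  "contract f w = (\<chi> a. \<Sum>i\<in>UNIV. \<Sum>b\<in>UNIV. f $ (i, a, b) * w $ (b, i))"

definition monad_surj :: "complex ^ (3 \<times> 'n \<times> 'n::finite) \<Rightarrow> bool" where
  "monad_surj f \<longleftrightarrow> (\<forall>x\<in>plane. contract f ` upper V_Omega2 x = upper V_O1 x)"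

definition rank_H0 :: "complex ^ (3 \<times> 'n \<times> 'n::finite) \<Rightarrow> enat" where
  "rank_H0 f = dim_mod ((\<lambda>\<omega> x. contract f (\<omega> x)) ` sections plane V_Omega2 0)
                       (null_sections plane V_O1)"

definition ker_H0 :: "complex ^ (3 \<times> 'n \<times> 'n::finite) \<Rightarrow> (complex ^ 3 \<Rightarrow> complex ^ ('n \<times> 3)) set" where
  "ker_H0 f = {\<omega> \<in> sections plane V_Omega2 0.
                (\<lambda>x. contract f (\<omega> x)) \<in> null_sections plane V_O1}"

text \<open>\<open>E(f) = Ker f / Im g\<close>, where \<open>g\<close> is evaluation of the sections in \<open>ker_H0 f\<close>.\<close>

definition monad_bundle :: "complex ^ (3 \<times> 'n \<times> 'n::finite) \<Rightarrow> ('n \<times> 3) vbundle" where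
  "monad_bundle f = \<lparr>upper = \<lambda>x. {w \<in> upper V_Omega2 x. contract f w = 0},
                     lower = \<lambda>x. {\<omega> x | \<omega>. \<omega> \<in> ker_H0 f}, twist = 1\<rparr>"

end

theory Submission
  imports Defs "HOL-Complex_Analysis.Cauchy_Integral_Formula"
begin

text \<open>
  Put \<open>k = n + r / 2\<close>. A tensor \<open>f\<close> acts on \<open>V\<^sup>\<or> \<otimes> H\<^sup>0(\<Omega>\<^sup>1(3))\<close> with values in
  \<open>V \<otimes> S\<^sup>2U\<^sup>\<or>\<close>. A rank-one tensor \<open>u \<otimes> v\<^sup>2\<close> has its image in \<open>v\<close> times the 5-dimensional space of
  quadratic forms vanishing at \<open>u\<close>, so this map has rank at most \<open>5k\<close> on spans of \<open>k\<close> points of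
  \<open>X\<close>. Since the vanishing of minors is a closed condition, the bound holds for every point of
  \<open>\<sigma>\<^sub>k(X)\<close>, and the general position in the theorem needs no closed set to be removed. The kernel has
  dimension at least \<open>8n - 5k\<close>; the sections that become zero in \<open>E(1)\<close> are those in
  \<open>I \<otimes> H\<^sup>0(\<O>(1))\<close>, of dimension \<open>3(n - r)\<close>, and \<open>8n - 5k - 3(n - r) = r / 2\<close>.

  The global sections of \<open>\<O>\<close> and \<open>\<O>(1)\<close> on the plane are found by applying Liouville's theorem on
  the affine lines \<open>t \<mapsto> x + t y\<close> of the cone.
\<close>

section \<open>Dimensions and minors\<close>

text \<open>Stated for an indexed family because the index sets below are often sets of functions or
  of indices. Injectivity of \<open>\<phi>\<close> comes for free: two equal members would give a
  relation with coefficients 1 and -1.\<close>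

lemma card_le_dim_of_independent_family:
  fixes \<phi> :: "'b \<Rightarrow> 'a::field ^ 'm"
  assumes "finite B" "\<phi> ` B \<subseteq> S"
    and ind: "\<And>c. (\<Sum>b\<in>B. c b *s \<phi> b) = 0 \<Longrightarrow> \<forall>b\<in>B. c b = 0"
  shows "card B \<le> vec.dim S"
proof -
  have inj: "inj_on \<phi> B"
  proof (rule inj_onI, rule ccontr)
    fix b b' assume b: "b \<in> B" "b' \<in> B" "\<phi> b = \<phi> b'" "b \<noteq> b'"
    define c where "c = (\<lambda>x. if x = b then 1 else if x = b' then -1 else 0 :: 'a)"
    have "(\<Sum>x\<in>B. c x *s \<phi> x) = (\<Sum>x\<in>{b, b'}. c x *s \<phi> x)"
      using assms(1) b by (intro sum.mono_neutral_right) (auto simp: c_def)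
    also have "\<dots> = 0" using b by (auto simp: c_def)
    finally have "c b = 0" using ind b by blast
    then show False by (simp add: c_def)
  qed
  have "vec.independent (\<phi> ` B)"
  proof (rule vec.independent_if_scalars_zero)
    show "finite (\<phi> ` B)" using assms by simp
    fix f x assume "(\<Sum>x\<in>\<phi> ` B. f x *s x) = 0" "x \<in> \<phi> ` B"
    then show "f x = 0"
      using ind[of "f \<circ> \<phi>"] inj by (auto simp: sum.reindex)
  qed
  then have "card (\<phi> ` B) \<le> vec.dim S"
    using assms(2) by (metis vec.dim_eq_card_independent vec.dim_subset)
  then show ?thesis using inj by (simp add: card_image)
qed

text \<open>A basis of \<open>N0\<close> is extended to one of \<open>N\<close>, and
  \<open>C\<close> consists of the added vectors. The last clause is independence modulo
  \<open>N0\<close>, the same form in which \<open>dim_mod\<close> measures a quotient.\<close>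

lemma complement_basis:
  fixes N N0 :: "('a::field ^ 'm) set"
  assumes "vec.subspace N" "vec.subspace N0" "N0 \<subseteq> N"
  obtains C where "finite C" "C \<subseteq> N" "card C + vec.dim N0 = vec.dim N" "N \<subseteq> vec.span (C \<union> N0)"
    "\<forall>c. (\<Sum>v\<in>C. c v *s v) \<in> N0 \<longrightarrow> (\<forall>v\<in>C. c v = 0)"
proof -
  obtain K where K: "K \<subseteq> N0" "vec.independent K" "N0 \<subseteq> vec.span K" "card K = vec.dim N0"
    using vec.basis_exists by blast
  obtain B where B: "K \<subseteq> B" "B \<subseteq> N" "vec.independent B" "N \<subseteq> vec.span B"
    using vec.maximal_independent_subset_extend[of K N] K assms(3) by blast
  have fB: "finite B" using B(3) by (rule vec.finiteI_independent)
  have fK: "finite K" using B(1) fB by (rule finite_subset)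
  show ?thesis
  proof
    show "finite (B - K)" using fB by simp
    show "B - K \<subseteq> N" using B by blast
    have "card B = vec.dim N" using B by (simp add: vec.basis_card_eq_dim)
    then show "card (B - K) + vec.dim N0 = vec.dim N"
      using B(1) fB K(4) by (metis card_Diff_subset card_mono fK le_add_diff_inverse2)
    show "N \<subseteq> vec.span (B - K \<union> N0)"
      using B(4) K(1) vec.span_mono[of B "B - K \<union> N0"] by blast
    show "\<forall>c. (\<Sum>v\<in>B - K. c v *s v) \<in> N0 \<longrightarrow> (\<forall>v\<in>B - K. c v = 0)"
    proof (intro allI impI)
      fix c assume "(\<Sum>v\<in>B - K. c v *s v) \<in> N0"
      then have "(\<Sum>v\<in>B - K. c v *s v) \<in> vec.span K" using K by blast
      then obtain u where u: "(\<Sum>v\<in>B - K. c v *s v) = (\<Sum>v\<in>K. u v *s v)"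
        using vec.span_finite[OF fK] by auto
      \<comment> \<open>Moving the \<open>K\<close>-part to the other side gives a single relation
        on the basis \<open>B\<close>.\<close>
      define w where "w v = (if v \<in> K then - u v else c v)" for v
      have "(\<Sum>v\<in>B. w v *s v) = (\<Sum>v\<in>B - K. w v *s v) + (\<Sum>v\<in>K. w v *s v)"
        by (rule sum.subset_diff[OF B(1) fB])
      also have "(\<Sum>v\<in>B - K. w v *s v) = (\<Sum>v\<in>B - K. c v *s v)"
        by (rule sum.cong) (auto simp: w_def)
      also have "(\<Sum>v\<in>K. w v *s v) = - (\<Sum>v\<in>K. u v *s v)"
        unfolding w_def by (simp add: sum_negf[symmetric])
      finally have "(\<Sum>v\<in>B. w v *s v) = 0" using u by simp
      then have "w v = 0" if "v \<in> B" for v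
        using vec.independentD[OF B(3) fB order_refl] that by blast
      then show "\<forall>v\<in>B - K. c v = 0" unfolding w_def by fastforce
    qed
  qed
qed

text \<open>A basis \<open>C\<close> of a complement of the kernel maps to a basis of the range:
  independence modulo the kernel gives one inequality, spanning the other.\<close>

lemma rank_nullity:
  fixes \<phi> :: "'a::field ^ 'm \<Rightarrow> 'a ^ 'n"
  assumes "Vector_Spaces.linear (*s) (*s) \<phi>"
  shows "vec.dim (range \<phi>) + vec.dim {v. \<phi> v = 0} = CARD('m)"
proof -
  interpret \<phi>: Vector_Spaces.linear "(*s)" "(*s)" \<phi> by fact
  obtain C where C: "finite C" "C \<subseteq> UNIV" "card C + vec.dim {v. \<phi> v = 0} = vec.dim (UNIV :: ('a ^ 'm) set)"
    "UNIV \<subseteq> vec.span (C \<union> {v. \<phi> v = 0})"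
    "\<forall>c. (\<Sum>v\<in>C. c v *s v) \<in> {v. \<phi> v = 0} \<longrightarrow> (\<forall>v\<in>C. c v = 0)"
    by (rule complement_basis[OF vec.subspace_UNIV \<phi>.subspace_kernel subset_UNIV])
  have "card C \<le> vec.dim (range \<phi>)"
    using C(5) by (intro card_le_dim_of_independent_family[OF C(1), of \<phi>]) (auto simp: \<phi>.sum \<phi>.scale)
  moreover have "range \<phi> \<subseteq> vec.span (\<phi> ` C)"
  proof -
    have "range \<phi> \<subseteq> \<phi> ` vec.span (C \<union> {v. \<phi> v = 0})" using C(4) by blast
    also have "\<dots> = vec.span (\<phi> ` (C \<union> {v. \<phi> v = 0}))" by (simp add: \<phi>.span_image)
    also have "\<dots> \<subseteq> vec.span (insert 0 (\<phi> ` C))" by (intro vec.span_mono) auto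
    finally show ?thesis by (simp add: vec.span_insert_0)
  qed
  then have "vec.dim (range \<phi>) \<le> card C"
    using C(1) by (meson card_image_le dual_order.trans finite_imageI vec.dim_le_card)
  ultimately show ?thesis using C(3) by (simp add: vec.dim_UNIV card_cart_basis)
qed

lemma dim_span_Union_le:
  fixes B :: "'b \<Rightarrow> ('a::field ^ 'm) set"
  assumes "finite T" "\<And>t. t \<in> T \<Longrightarrow> finite (B t)" "\<And>t. t \<in> T \<Longrightarrow> card (B t) \<le> d"
    and "S \<subseteq> vec.span (\<Union>t\<in>T. B t)"
  shows "vec.dim S \<le> d * card T"
proof -
  have "vec.dim S \<le> card (\<Union>t\<in>T. B t)"
    using assms by (intro vec.dim_le_card) auto
  also have "\<dots> \<le> (\<Sum>t\<in>T. card (B t))" by (rule card_UN_le[OF assms(1)])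
  also have "\<dots> \<le> d * card T" using sum_bounded_above[of T "\<lambda>t. card (B t)" d] assms(3) by (simp add: mult.commute)
  finally show ?thesis .
qed

text \<open>Minors are written as determinants in which the rows outside \<open>J\<close> are arbitrary constants;
  this avoids matrices whose size is not a type.\<close>

lemma dim_le_iff_minors_vanish:
  fixes \<phi> :: "'m \<Rightarrow> 'a::field ^ 'm"
  shows "vec.dim (range \<phi>) \<le> d \<longleftrightarrow>
    (\<forall>J c. card J = Suc d \<longrightarrow> det (\<chi> i. if i \<in> J then \<phi> i else c i) = 0)"
proof (intro iffI allI impI)
  fix J :: "'m set" and c
  assume d: "vec.dim (range \<phi>) \<le> d" and J: "card J = Suc d"
  show "det (\<chi> i. if i \<in> J then \<phi> i else c i) = 0" (is "det ?A = 0")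
  proof (rule ccontr)
    \<comment> \<open>A nonsingular matrix has independent rows, in particular those indexed by
      \<open>J\<close>, which are values of \<open>\<phi>\<close>.\<close>
    assume "det ?A \<noteq> 0"
    then obtain B where "?A ** B = mat 1" using invertible_det_nz[of ?A] invertible_right_inverse by blast
    then have *: "\<forall>c. (\<Sum>i\<in>UNIV. c i *s row i ?A) = 0 \<longrightarrow> (\<forall>i. c i = 0)"
      using matrix_right_invertible_independent_rows[of ?A] by auto
    have "card J \<le> vec.dim (range \<phi>)"
    proof (rule card_le_dim_of_independent_family)
      fix k assume k: "(\<Sum>b\<in>J. k b *s \<phi> b) = 0"
      define k' where "k' i = (if i \<in> J then k i else 0)" for i
      have "(\<Sum>i\<in>UNIV. k' i *s row i ?A) = (\<Sum>i\<in>J. k i *s \<phi> i)"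
        by (rule sum.mono_neutral_cong_right) (auto simp: k'_def row_def vec_eq_iff)
      then have "\<forall>i. k' i = 0" using k * by auto
      then show "\<forall>b\<in>J. k b = 0" by (metis k'_def)
    qed auto
    then show False using d J by simp
  qed
next
  assume minors: "\<forall>J c. card J = Suc d \<longrightarrow> det (\<chi> i. if i \<in> J then \<phi> i else c i) = 0"
  show "vec.dim (range \<phi>) \<le> d"
  proof (rule ccontr)
    assume "\<not> ?thesis"
    then have d: "Suc d \<le> vec.dim (range \<phi>)" by simp
    obtain B0 where B0: "B0 \<subseteq> range \<phi>" "vec.independent B0" "card B0 = vec.dim (range \<phi>)"
      by (rule vec.basis_exists[of "range \<phi>"])
    obtain B where B: "B \<subseteq> B0" "card B = Suc d"
      using d obtain_subset_with_card_n[of "Suc d" B0] unfolding B0(3) by blast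
    have "vec.independent B" using B0 B vec.independent_mono by blast
    \<comment> \<open>The vectors added to complete \<open>B\<close> to a basis of the whole space
      serve as the constant rows \<open>c\<close> of a nonzero minor.\<close>
    then obtain B' where B': "B \<subseteq> B'" "vec.independent B'" "vec.span B' = UNIV"
      using vec.maximal_independent_subset_extend[OF subset_UNIV] by (metis top.extremum_uniqueI)
    have fB': "finite B'" using B'(2) by (rule vec.finiteI_independent)
    have cB': "card B' = CARD('m)"
      using vec.dim_eq_card[of B' UNIV] B'(2,3) by (simp add: vec.dim_UNIV card_cart_basis)
    obtain J where J: "inj_on \<phi> J" "B = \<phi> ` J"
      using subset_image_inj[THEN iffD1, OF subset_trans[OF B(1) B0(1)]] by auto
    have cJ: "card J = Suc d" using J B by (simp add: card_image)
    have "card (UNIV - J) = card (B' - B)"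
      using cJ B(2) cB' card_Diff_subset[OF finite_subset[OF B'(1) fB'] B'(1)]
      by (simp add: card_Diff_subset)
    then obtain c where c: "bij_betw c (UNIV - J) (B' - B)"
      using finite_same_card_bij[of "UNIV - J" "B' - B"] fB' by auto
    define A where "A = (\<chi> i. if i \<in> J then \<phi> i else c i)"
    have row: "row i A = (if i \<in> J then \<phi> i else c i)" for i by (simp add: A_def row_def vec_eq_iff)
    have "rows A = (\<lambda>i. row i A) ` (J \<union> (UNIV - J))" by (auto simp: rows_def)
    also have "\<dots> = \<phi> ` J \<union> c ` (UNIV - J)" unfolding image_Un by (simp add: row)
    also have "\<dots> = B \<union> (B' - B)" unfolding bij_betw_imp_surj_on[OF c] J(2) ..
    also have "\<dots> = B'" using B'(1) by blast
    finally have "vec.span (rows A) = UNIV" using B' by simp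
    then have "invertible A"
      using matrix_left_invertible_span_rows_gen[of A] invertible_left_inverse by blast
    then show False using minors cJ invertible_det_nz[of A] by (auto simp: A_def)
  qed
qed

section \<open>Forms and regular functions on the plane\<close>

lemma form_mult: "form d p \<Longrightarrow> form e q \<Longrightarrow> form (d + e) (\<lambda>x. p x * q x)"
proof (induction rule: form.induct)
  case (const c)
  from \<open>form e q\<close> show ?case
  proof (induction rule: form.induct)
    case (coord d p i)
    then have "form (0 + Suc d) (\<lambda>x. x $ i * (c * p x))" using form.coord by simp
    then show ?case by (simp add: mult.left_commute)
  qed (auto intro: form.intros simp: distrib_left)
qed (auto intro: form.intros simp: mult.assoc distrib_right)

lemma form_cmult: "form d p \<Longrightarrow> form d (\<lambda>x. c * p x)"
  using form_mult[OF form.const] by fastforce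

lemma form_diff: "form d p \<Longrightarrow> form d q \<Longrightarrow> form d (\<lambda>x. p x - q x)"
  using form.add[of d p "\<lambda>x. - 1 * q x"] form_cmult[of d q "-1"] by simp

lemma form_zero: "form d (\<lambda>_. 0)"
proof (induction d)
  case (Suc d)
  then show ?case using form.coord[of d "\<lambda>_. 0"] by simp
qed (rule form.const)

lemma form_sum: "(\<And>i. i \<in> A \<Longrightarrow> form d (p i)) \<Longrightarrow> form d (\<lambda>x. \<Sum>i\<in>A. p i x)"
  by (induction A rule: infinite_finite_induct) (auto intro: form.intros form_zero)

lemma form_prod:
  "finite A \<Longrightarrow> (\<And>i. i \<in> A \<Longrightarrow> form (d i) (p i)) \<Longrightarrow> form (sum d A) (\<lambda>x. \<Prod>i\<in>A. p i x)"
  by (induction A rule: finite_induct) (auto intro: form.intros form_mult)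

lemma form_coord: "form 1 (\<lambda>x. x $ i)"
  using form.coord[OF form.const[of 1], of i] by simp

lemma form_det:
  fixes A :: "complex ^ 'k::finite \<Rightarrow> complex ^ 'm ^ 'm"
  assumes "\<And>i j. form (d i) (\<lambda>x. A x $ i $ j)"
  shows "form (\<Sum>i\<in>UNIV. d i) (\<lambda>x. det (A x))"
  unfolding det_def by (intro form_sum form_cmult form_prod finite_class.finite_UNIV assms)

lemma form_linear:
  fixes \<phi> :: "complex ^ 'k::finite \<Rightarrow> complex ^ 'm"
  assumes "Vector_Spaces.linear (*s) (*s) \<phi>"
  shows "form 1 (\<lambda>x. \<phi> x $ i)"
proof -
  have "\<phi> x $ i = (\<Sum>j\<in>UNIV. matrix \<phi> $ i $ j * x $ j)" for x
    unfolding matrix_works[OF assms, of x, symmetric] by (simp add: matrix_vector_mult_def)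
  then show ?thesis by (simp only:) (intro form_sum form_cmult form_coord)
qed

lemma form_scale: "form d p \<Longrightarrow> p (c *s x) = c ^ d * p x"
  by (induction rule: form.induct) (auto simp: algebra_simps)

lemma form_holomorphic: "form d p \<Longrightarrow> (\<lambda>t. p (x + t *s y)) holomorphic_on A"
  by (induction rule: form.induct) (auto intro!: holomorphic_intros)

lemma zopen_plane: "zopen plane"
  unfolding zopen_def zclosed_def
  by (intro exI[of _ "{}"] conjI exI[of _ "{\<lambda>_. 1}"]) (auto intro: form.const)

lemma form_regular: "form d p \<Longrightarrow> regular D (int d) p"
  unfolding regular_def
  by (intro ballI exI[of _ d] exI[of _ 0] exI[of _ p] exI[of _ "\<lambda>_. 1"]) (auto intro: form.const)

text \<open>In \<open>regular\<close>, a fraction must represent the function wherever its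
  denominator is nonzero on the whole plane. Multiplying numerator and denominator by a form
  \<open>g\<close> that vanishes off \<open>D\<close> but not at \<open>x\<close> confines that
  locus to \<open>D\<close>.\<close>

lemma regular_local:
  assumes "\<And>x. x \<in> plane \<Longrightarrow> \<exists>D h'. zopen D \<and> x \<in> D \<and> regular D e h' \<and> (\<forall>y\<in>D. h y = h' y)"
  shows "regular plane e h"
  unfolding regular_def
proof
  fix x assume "x \<in> plane"
  then obtain D h' where D: "zopen D" "x \<in> D" "regular D e h'" "\<forall>y\<in>D. h y = h' y" using assms by blast
  obtain i j p q where pq: "form i p" "form j q" "int i - int j = e" "q x \<noteq> 0"
    "\<And>y. y \<in> D \<Longrightarrow> q y \<noteq> 0 \<Longrightarrow> h' y = p y / q y"
    using D(2,3) unfolding regular_def by blast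
  obtain P where P: "\<forall>p\<in>P. \<exists>d. form d p" "D = plane - {x. x \<noteq> 0 \<and> (\<forall>p\<in>P. p x = 0)}"
    using D(1) unfolding zopen_def zclosed_def by auto
  then obtain g d where g: "g \<in> P" "form d g" "g x \<noteq> 0" using D(2) by blast
  show "\<exists>i j p q. form i p \<and> form j q \<and> int i - int j = e \<and> q x \<noteq> 0 \<and>
      (\<forall>y\<in>plane. q y \<noteq> 0 \<longrightarrow> h y = p y / q y)"
  proof (intro exI conjI ballI impI)
    show "form (i + d) (\<lambda>x. p x * g x)" "form (j + d) (\<lambda>x. q x * g x)" using pq g form_mult by blast+
    show "int (i + d) - int (j + d) = e" using pq by simp
    show "q x * g x \<noteq> 0" using pq g by simp
    fix y assume y: "y \<in> plane" "q y * g y \<noteq> 0"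
    then have "y \<in> D" using P g by auto
    then show "h y = p y * g y / (q y * g y)" using pq(5) D(4) y by simp
  qed
qed

section \<open>Restriction of sections to affine lines of the cone\<close>

lemma regular_scale:
  assumes "regular plane (int e) h" "x \<noteq> 0" "c \<noteq> 0"
  shows "h (c *s x) = c ^ e * h x"
proof -
  obtain i j p q where pq: "form i p" "form j q" "int i - int j = int e" "q x \<noteq> 0"
    "\<And>y. y \<in> plane \<Longrightarrow> q y \<noteq> 0 \<Longrightarrow> h y = p y / q y"
    using assms unfolding regular_def by blast
  have "i = j + e" using pq(3) by linarith
  then have "h (c *s x) = c ^ (j + e) * p x / (c ^ j * q x)"
    using pq(4,5) assms by (simp add: form_scale[OF pq(1)] form_scale[OF pq(2)])
  then show ?thesis using assms pq(4) pq(5)[of x] by (simp add: power_add)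
qed

lemma regular_holomorphic:
  assumes h: "regular plane e h" and nz: "\<And>t. x + t *s y \<noteq> 0"
  shows "(\<lambda>t. h (x + t *s y)) holomorphic_on UNIV"
proof -
  have "(\<lambda>t. h (x + t *s y)) field_differentiable at t" for t
  proof -
    obtain i j p q where pq: "form i p" "form j q" "q (x + t *s y) \<noteq> 0"
      "\<And>y. y \<in> plane \<Longrightarrow> q y \<noteq> 0 \<Longrightarrow> h y = p y / q y"
      using h nz[of t] unfolding regular_def by blast
    let ?p = "\<lambda>t. p (x + t *s y)" and ?q = "\<lambda>t. q (x + t *s y)"
    have hol: "?p holomorphic_on UNIV" "?q holomorphic_on UNIV"
      using form_holomorphic pq by blast+
    have "open {t. ?q t \<noteq> 0}"
      using holomorphic_on_imp_continuous_on[OF hol(2)]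
      by (intro open_Collect_neq continuous_intros) auto
    then have ev: "\<forall>\<^sub>F s in nhds t. ?p s / ?q s = h (x + s *s y)"
      using pq(3,4) nz by (auto simp: eventually_nhds)
    have "(\<lambda>s. ?p s / ?q s) field_differentiable at t"
      using hol pq(3) by (intro field_differentiable_divide)
        (auto simp: holomorphic_on_def)
    then obtain D where "((\<lambda>s. ?p s / ?q s) has_field_derivative D) (at t)"
      unfolding field_differentiable_def by blast
    then have "((\<lambda>s. h (x + s *s y)) has_field_derivative D) (at t)"
      using DERIV_cong_ev[OF refl ev refl] by simp
    then show ?thesis unfolding field_differentiable_def by blast
  qed
  then show ?thesis by (simp add: holomorphic_on_def)
qed

text \<open>The restriction to a line is entire of growth at most \<open>e\<close>, because
  \<open>h (x + t y) = t\<^sup>e h (y + x / t)\<close>.\<close>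

lemma regular_on_line:
  assumes h: "regular plane (int e) h" and nz: "\<forall>a b. a *s x + b *s y = 0 \<longrightarrow> a = 0 \<and> b = 0"
  shows "\<exists>a. \<forall>t. h (x + t *s y) = (\<Sum>k\<le>e. a k * t ^ k)"
    and "((\<lambda>t. h (x + t *s y) / t ^ e) \<longlongrightarrow> h y) at_infinity"
proof -
  have xy: "x + t *s y \<noteq> 0" for t using nz[rule_format, of 1 t] by auto
  have yx: "y + t *s x \<noteq> 0" for t using nz[rule_format, of t 1] by (auto simp: add.commute)
  have hol: "(\<lambda>t. h (x + t *s y)) holomorphic_on UNIV" by (rule regular_holomorphic[OF h xy])
  have "(\<lambda>t. h (y + t *s x)) holomorphic_on UNIV" by (rule regular_holomorphic[OF h yx])
  then have "isCont (\<lambda>t. h (y + t *s x)) 0"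
    using holomorphic_on_imp_continuous_on continuous_on_eq_continuous_at open_UNIV by blast
  then have "((\<lambda>t. h (y + t *s x)) \<longlongrightarrow> h y) (at 0)" by (simp add: isCont_def)
  \<comment> \<open>Replacing \<open>t\<close> by its inverse turns continuity at \<open>y\<close>
    in the direction \<open>x\<close> into a limit at infinity.\<close>
  then have lim: "((\<lambda>t. h (y + inverse t *s x)) \<longlongrightarrow> h y) at_infinity"
    unfolding at_to_infinity filterlim_filtermap .
  show "((\<lambda>t. h (x + t *s y) / t ^ e) \<longlongrightarrow> h y) at_infinity"
  proof (rule Lim_transform_eventually[OF lim])
    have "h (y + inverse t *s x) = h (x + t *s y) / t ^ e" if "t \<noteq> 0" for t
    proof -
      have eq: "x + t *s y = t *s (y + inverse t *s x)" using that by (simp add: vec.scale_right_distrib)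
      have "h (x + t *s y) = t ^ e * h (y + inverse t *s x)"
        unfolding eq by (rule regular_scale[OF h yx that])
      then show ?thesis using that by simp
    qed
    then show "\<forall>\<^sub>F t in at_infinity. h (y + inverse t *s x) = h (x + t *s y) / t ^ e"
      unfolding eventually_at_infinity by (metis norm_zero not_one_le_zero)
  qed
  then have "\<forall>\<^sub>F t in at_infinity. norm (h (x + t *s y) / t ^ e) < norm (h y) + 1"
    by (intro order_tendstoD[OF tendsto_norm]) auto
  then obtain A where A: "\<And>t. A \<le> norm t \<Longrightarrow> norm (h (x + t *s y) / t ^ e) < norm (h y) + 1"
    unfolding eventually_at_infinity by blast
  have "norm (h (x + t *s y)) \<le> (norm (h y) + 1) * norm t ^ e" if "max A 1 \<le> norm t" for t
  proof -
    have "t \<noteq> 0" using that by auto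
    then show ?thesis using A[of t] that by (simp add: norm_divide norm_power field_simps)
  qed
  from Liouville_polynomial[OF hol this]
  have "h (x + t *s y) = (\<Sum>k\<le>e. (deriv ^^ k) (\<lambda>z. h (x + z *s y)) 0 / fact k * t ^ k)" for t .
  then show "\<exists>a. \<forall>t. h (x + t *s y) = (\<Sum>k\<le>e. a k * t ^ k)"
    by (intro exI[of _ "\<lambda>k. (deriv ^^ k) (\<lambda>z. h (x + z *s y)) 0 / fact k"] allI)
qed

text \<open>The case distinction behind the use of lines: for independent \<open>x\<close>,
  \<open>y\<close> the line \<open>x + t *s y\<close> avoids the origin, where
  \<open>regular plane\<close> gives no control; for dependent ones \<open>regular_scale\<close>
  suffices.\<close>

lemma dependent_or_independent:
  fixes x y :: "'a::field ^ 'n"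
  assumes "x \<noteq> 0" "y \<noteq> 0"
  obtains c where "c \<noteq> 0" "y = c *s x" | "\<forall>a b. a *s x + b *s y = 0 \<longrightarrow> a = 0 \<and> b = 0"
proof (cases "\<exists>c. y = c *s x")
  case True
  then show ?thesis using assms that(1) by auto
next
  case False
  show ?thesis
  proof (rule that(2), intro allI impI)
    fix a b assume ab: "a *s x + b *s y = 0"
    have "b = 0"
    proof (rule ccontr)
      assume b: "b \<noteq> 0"
      have "b *s y = (- a) *s x" using ab by (simp add: eq_neg_iff_add_eq_0 add.commute)
      then have "inverse b *s (b *s y) = inverse b *s ((- a) *s x)" by simp
      then have "y = (inverse b * (- a)) *s x" using b by (simp only: vec.scale_scale) simp
      then show False using False by blast
    qed
    then show "a = 0 \<and> b = 0" using ab assms by auto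
  qed
qed

text \<open>On a line through \<open>x\<close> in an independent direction \<open>y\<close> the
  function is constant; its value at \<open>t = 0\<close> is \<open>h x\<close> and its limit at
  infinity is \<open>h y\<close>.\<close>

lemma regular_0_constant:
  assumes h: "regular plane 0 h" and "x \<noteq> 0" "y \<noteq> 0"
  shows "h x = h y"
  using assms(2,3)
proof (cases rule: dependent_or_independent)
  case (1 c)
  then show ?thesis using regular_scale[of 0 h x c] h assms by simp
next
  case 2
  from h have h0: "regular plane (int 0) h" by simp
  obtain a where a: "\<And>t. h (x + t *s y) = a" using regular_on_line(1)[OF h0 2] by auto
  have "((\<lambda>t::complex. a) \<longlongrightarrow> h y) at_infinity" using regular_on_line(2)[OF h0 2] a by simp
  then have "a = h y" by (metis tendsto_const_iff trivial_limit_at_infinity)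
  then show ?thesis using a[of 0] by simp
qed

text \<open>On the line the function is \<open>a 0 + a 1 * t\<close>. Here \<open>a 0 = h x\<close>,
  while the limit of the quotient by \<open>t\<close> at infinity gives \<open>a 1 = h y\<close>;
  then put \<open>t = 1\<close>.\<close>

lemma regular_1_add:
  assumes h: "regular plane 1 h" and nz: "\<forall>a b. a *s x + b *s y = 0 \<longrightarrow> a = 0 \<and> b = 0"
  shows "h (x + y) = h x + h y"
proof -
  from h have h1: "regular plane (int 1) h" by simp
  obtain a where "\<forall>t. h (x + t *s y) = (\<Sum>k\<le>1. a k * t ^ k)"
    using regular_on_line(1)[OF h1 nz] by blast
  then have a: "h (x + t *s y) = a 0 + a 1 * t" for t by simp
  have "((\<lambda>t. a 0 / t + a 1) \<longlongrightarrow> 0 + a 1) at_infinity"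
    by (intro tendsto_intros tendsto_divide_0[OF tendsto_const] filterlim_ident)
  moreover have "((\<lambda>t. a 0 / t + a 1) \<longlongrightarrow> h y) at_infinity"
  proof (rule Lim_transform_eventually[OF regular_on_line(2)[OF h1 nz]])
    show "\<forall>\<^sub>F t in at_infinity. h (x + t *s y) / t ^ 1 = a 0 / t + a 1"
      unfolding eventually_at_infinity
    proof (intro exI[of _ 1] allI impI)
      fix t :: complex assume "1 \<le> norm t"
      then have "t \<noteq> 0" by auto
      then show "h (x + t *s y) / t ^ 1 = a 0 / t + a 1" by (simp add: a add_divide_distrib)
    qed
  qed
  ultimately have "a 1 = h y" using tendsto_unique[OF trivial_limit_at_infinity] by fastforce
  then show ?thesis using a[of 0] a[of 1] by simp
qed

lemma regular_1_linear:
  assumes h: "regular plane 1 h"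
  obtains c where "\<And>x. x \<noteq> 0 \<Longrightarrow> h x = (\<Sum>j\<in>UNIV. c j * x $ j)"
proof -
  \<comment> \<open>The value of \<open>h\<close> at the origin is arbitrary; with the value 0 there
    the function becomes linear on all of \<open>U\<close>.\<close>
  define k where "k x = (if x = 0 then 0 else h x)" for x
  have scale: "k (c *s x) = c * k x" for c x
    using regular_scale[of 1 h x c] h by (auto simp: k_def)
  have add: "k (x + y) = k x + k y" for x y
  proof (cases "x = 0 \<or> y = 0")
    case False
    then have "x \<noteq> 0" "y \<noteq> 0" by auto
    then show ?thesis
    proof (cases rule: dependent_or_independent)
      case (1 c)
      have "k (x + y) = k ((1 + c) *s x)" using 1 by (simp add: vec.scale_left_distrib)
      also have "\<dots> = k x + k y" unfolding scale 1 by (simp add: distrib_right)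
      finally show ?thesis .
    next
      case 2
      then have "x + y \<noteq> 0" using 2[rule_format, of 1 1] by auto
      then show ?thesis using regular_1_add[OF h 2] False by (simp add: k_def)
    qed
  qed (auto simp: k_def)
  have sum: "k (\<Sum>j\<in>A. g j) = (\<Sum>j\<in>A. k (g j))" for A :: "3 set" and g
    by (induction A rule: infinite_finite_induct) (auto simp: add, auto simp: k_def)
  have "h x = (\<Sum>j\<in>UNIV. k (axis j 1) * x $ j)" if "x \<noteq> 0" for x
  proof -
    have "h x = k x" using that by (simp add: k_def)
    also have "\<dots> = k (\<Sum>j\<in>UNIV. x $ j *s axis j 1)" by (simp add: basis_expansion)
    also have "\<dots> = (\<Sum>j\<in>UNIV. k (axis j 1) * x $ j)" by (simp add: sum scale mult.commute)
    finally show ?thesis .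
  qed
  then show ?thesis by (rule that)
qed

section \<open>The rank of a tensor on quadratic sections\<close>

text \<open>The cross product. Read as a linear form, \<open>vprod v x\<close> vanishes at
  \<open>x\<close>, so it lies in the fibre of \<Omega>^1(2) at \<open>x\<close>.\<close>

definition vprod :: "complex ^ 3 \<Rightarrow> complex ^ 3 \<Rightarrow> complex ^ 3" where
  "vprod v x = vector [v $ 2 * x $ 3 - v $ 3 * x $ 2, v $ 3 * x $ 1 - v $ 1 * x $ 3,
                       v $ 1 * x $ 2 - v $ 2 * x $ 1]"

lemma vprod_nth [simp]:
  "vprod v x $ 1 = v $ 2 * x $ 3 - v $ 3 * x $ 2"
  "vprod v x $ 2 = v $ 3 * x $ 1 - v $ 1 * x $ 3"
  "vprod v x $ 3 = v $ 1 * x $ 2 - v $ 2 * x $ 1"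
  by (simp_all add: vprod_def vector_3)

text \<open>
  Linear sections of \<open>V\<^sup>\<or> \<otimes> \<Omega>\<^sup>1(2)\<close> are the \<open>x \<mapsto> w \<times> x\<close>, and quadratic sections are the
  \<open>x \<mapsto> (M x) \<times> x\<close>. The matrix \<open>M\<close> is determined only up to the \<open>n\<close>-dimensional space of scalar
  matrices, so that \<open>9n\<close> takes the place of \<open>8n\<close> in the dimension count.
\<close>

definition wedge :: "complex ^ ('n::finite \<times> 3) \<Rightarrow> complex ^ 3 \<Rightarrow> complex ^ ('n \<times> 3)" where
  "wedge w x = (\<chi> p. vprod (\<chi> i. w $ (fst p, i)) x $ snd p)"

text \<open>For nonzero \<open>x\<close> these are the elements that \<open>wedge\<close> with
  \<open>x\<close> kills.\<close>

definition tens :: "complex ^ 'n::finite \<Rightarrow> complex ^ 3 \<Rightarrow> complex ^ ('n \<times> 3)" where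
  "tens l x = (\<chi> p. l $ fst p * x $ snd p)"

definition mapply :: "complex ^ ('n::finite \<times> 3 \<times> 3) \<Rightarrow> complex ^ 3 \<Rightarrow> complex ^ ('n \<times> 3)" where
  "mapply M x = (\<chi> p. \<Sum>j\<in>UNIV. M $ (fst p, snd p, j) * x $ j)"

definition quad :: "complex ^ ('n::finite \<times> 3 \<times> 3) \<Rightarrow> complex ^ 3 \<Rightarrow> complex ^ ('n \<times> 3)" where
  "quad M x = wedge (mapply M x) x"

text \<open>This is H^0(f) in coordinates: \<open>w\<close> stands for the section
  \<open>wedge w\<close>, and the values are the coefficients of the resulting linear forms.\<close>

definition lin_coeffs :: "complex ^ (3 \<times> 'n \<times> 'n) \<Rightarrow> complex ^ ('n::finite \<times> 3) \<Rightarrow> complex ^ ('n \<times> 3)" where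
  "lin_coeffs f w = (\<chi> p. contract f (wedge w (axis (snd p) 1)) $ fst p)"

text \<open>The map induced by \<open>f\<close> on quadratic sections. The coefficients are
  symmetrized without dividing by 2, whence the factor 2 in \<open>contract_quad\<close>.\<close>

definition quad_coeffs ::
    "complex ^ (3 \<times> 'n \<times> 'n) \<Rightarrow> complex ^ ('n::finite \<times> 3 \<times> 3) \<Rightarrow> complex ^ ('n \<times> 3 \<times> 3)" where
  "quad_coeffs f M = (\<chi> p. case p of (a, j, l) \<Rightarrow>
     contract f (wedge (mapply M (axis j 1)) (axis l 1) + wedge (mapply M (axis l 1)) (axis j 1)) $ a)"

interpretation wedge_left: Vector_Spaces.linear "(*s)" "(*s)" "\<lambda>w. wedge w x" for x
  by unfold_locales (simp_all add: vec_eq_iff forall_3 wedge_def algebra_simps)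

interpretation wedge_right: Vector_Spaces.linear "(*s)" "(*s)" "wedge w" for w
  by unfold_locales (simp_all add: vec_eq_iff forall_3 wedge_def algebra_simps)

interpretation tens_left: Vector_Spaces.linear "(*s)" "(*s)" "\<lambda>l. tens l x" for x
  by unfold_locales (auto simp: vec_eq_iff tens_def algebra_simps)

interpretation tens_right: Vector_Spaces.linear "(*s)" "(*s)" "tens l" for l
  by unfold_locales (auto simp: vec_eq_iff tens_def algebra_simps)

interpretation mapply_left: Vector_Spaces.linear "(*s)" "(*s)" "\<lambda>M. mapply M x" for x
  by unfold_locales (auto simp: vec_eq_iff mapply_def algebra_simps sum.distrib sum_distrib_left)

interpretation mapply_right: Vector_Spaces.linear "(*s)" "(*s)" "mapply M" for M
  by unfold_locales (auto simp: vec_eq_iff mapply_def algebra_simps sum.distrib sum_distrib_left)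

interpretation contract_left: Vector_Spaces.linear "(*s)" "(*s)" "\<lambda>f. contract f w" for w
  by unfold_locales (auto simp: vec_eq_iff contract_def algebra_simps sum.distrib sum_distrib_left)

interpretation contract_right: Vector_Spaces.linear "(*s)" "(*s)" "contract f" for f
  by unfold_locales (auto simp: vec_eq_iff contract_def algebra_simps sum.distrib sum_distrib_left)

interpretation lin_coeffs: Vector_Spaces.linear "(*s)" "(*s)" "lin_coeffs f" for f
  by unfold_locales
    (auto simp: vec_eq_iff lin_coeffs_def wedge_left.add wedge_left.scale contract_right.add contract_right.scale)

interpretation quad_coeffs_left: Vector_Spaces.linear "(*s)" "(*s)" "\<lambda>f. quad_coeffs f M" for M
  by unfold_locales
    (auto simp: vec_eq_iff quad_coeffs_def contract_left.add contract_left.scale)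

interpretation quad_coeffs_right: Vector_Spaces.linear "(*s)" "(*s)" "quad_coeffs f" for f
  by unfold_locales
    (auto simp: vec_eq_iff quad_coeffs_def mapply_left.add mapply_left.scale wedge_left.add wedge_left.scale
      contract_right.add contract_right.scale algebra_simps)

interpretation quad: Vector_Spaces.linear "(*s)" "(*s)" "\<lambda>M. quad M x" for x
  by unfold_locales
    (auto simp: quad_def mapply_left.add mapply_left.scale wedge_left.add wedge_left.scale)

lemma mapply_axis: "mapply M (axis j 1) = (\<chi> p. M $ (fst p, snd p, j))"
  by (simp add: mapply_def vec_eq_iff axis_def if_distrib cong: if_cong)

lemma contract_wedge: "contract f (wedge w x) $ a = (\<Sum>j\<in>UNIV. lin_coeffs f w $ (a, j) * x $ j)"
proof -
  have "contract f (wedge w x) = contract f (wedge w (\<Sum>j\<in>UNIV. x $ j *s axis j 1))"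
    by (simp add: basis_expansion)
  also have "\<dots> = (\<Sum>j\<in>UNIV. x $ j *s contract f (wedge w (axis j 1)))"
    by (simp only: wedge_right.sum wedge_right.scale contract_right.sum contract_right.scale)
  finally show ?thesis by (simp add: lin_coeffs_def mult.commute)
qed

lemma contract_quad:
  "2 * contract f (quad M x) $ a = (\<Sum>j\<in>UNIV. \<Sum>l\<in>UNIV. x $ j * x $ l * quad_coeffs f M $ (a, j, l))"
proof -
  let ?C = "\<lambda>j l. contract f (wedge (mapply M (axis j 1)) (axis l 1)) $ a"
  have "contract f (quad M x) = contract f (wedge (mapply M (\<Sum>j\<in>UNIV. x $ j *s axis j 1)) (\<Sum>l\<in>UNIV. x $ l *s axis l 1))"
    by (simp add: basis_expansion quad_def)
  also have "\<dots> = (\<Sum>l\<in>UNIV. x $ l *s (\<Sum>j\<in>UNIV. x $ j *s contract f (wedge (mapply M (axis j 1)) (axis l 1))))"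
    by (simp only: wedge_right.sum wedge_right.scale contract_right.sum contract_right.scale
        mapply_right.sum mapply_right.scale wedge_left.sum wedge_left.scale)
  finally have 1: "contract f (quad M x) $ a = (\<Sum>l\<in>UNIV. \<Sum>j\<in>UNIV. x $ j * x $ l * ?C j l)"
    by (simp add: sum_distrib_left mult_ac)
  \<comment> \<open>Exchanging \<open>j\<close> and \<open>l\<close> gives a second expansion;
    adding the two symmetrizes the coefficients.\<close>
  also have "\<dots> = (\<Sum>l\<in>UNIV. \<Sum>j\<in>UNIV. x $ j * x $ l * ?C l j)"
    by (subst sum.swap) (simp add: mult_ac)
  finally have 2: "contract f (quad M x) $ a = (\<Sum>l\<in>UNIV. \<Sum>j\<in>UNIV. x $ j * x $ l * ?C l j)" .
  have "2 * contract f (quad M x) $ a = (\<Sum>l\<in>UNIV. \<Sum>j\<in>UNIV. x $ j * x $ l * (?C j l + ?C l j))"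
    unfolding distrib_left sum.distrib 1[symmetric] 2[symmetric] by simp
  also have "\<dots> = (\<Sum>j\<in>UNIV. \<Sum>l\<in>UNIV. x $ j * x $ l * (?C j l + ?C l j))" by (rule sum.swap)
  finally show ?thesis by (simp add: quad_coeffs_def contract_right.add)
qed

text \<open>The quadratic forms \<open>x \<mapsto> det (u, P x, x)\<close> vanish at \<open>u\<close>; hence the rank drops from 6 to 5.\<close>

definition det_form :: "complex ^ 3 \<Rightarrow> complex ^ (3 \<times> 3) \<Rightarrow> complex ^ (3 \<times> 3)" where
  "det_form u P = (\<chi> q. \<Sum>i\<in>UNIV. u $ i *
     (vprod (\<chi> k. P $ (k, fst q)) (axis (snd q) 1) + vprod (\<chi> k. P $ (k, snd q)) (axis (fst q) 1)) $ i)"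

interpretation det_form: Vector_Spaces.linear "(*s)" "(*s)" "det_form u" for u
  by unfold_locales (auto simp: vec_eq_iff det_form_def sum_3 algebra_simps)

text \<open>The kernel contains four independent matrices: the identity, and for each
  \<open>m\<close> the matrix sending \<open>x\<close> to \<open>x $ m\<close> times
  \<open>u\<close>. Each makes two columns of det(u, P x, x) proportional. Of the 9 dimensions at
  most 5 remain.\<close>

lemma dim_range_det_form:
  assumes "u \<noteq> 0"
  shows "vec.dim (range (det_form u)) \<le> 5"
proof -
  define \<phi> :: "3 option \<Rightarrow> complex ^ (3 \<times> 3)" where
    "\<phi> b = (\<chi> q. case b of None \<Rightarrow> if fst q = snd q then 1 else 0
                | Some m \<Rightarrow> if snd q = m then u $ fst q else 0)" for b
  have "card (UNIV :: 3 option set) \<le> vec.dim {P. det_form u P = 0}"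
  proof (rule card_le_dim_of_independent_family)
    show "range \<phi> \<subseteq> {P. det_form u P = 0}"
    proof (clarsimp)
      fix b show "det_form u (\<phi> b) = 0"
        by (cases b) (auto simp: \<phi>_def det_form_def vec_eq_iff forall_3 sum_3 axis_def)
    qed
    fix c assume c: "(\<Sum>b\<in>UNIV. c b *s \<phi> b) = 0"
    have eq: "c None * (if k = j then 1 else 0) + c (Some j) * u $ k = 0" for k j
    proof -
      have "(\<Sum>b\<in>UNIV. c b *s \<phi> b) $ (k, j) = c None * (if k = j then 1 else 0) + (\<Sum>m\<in>UNIV. c (Some m) * (if j = m then u $ k else 0))"
        by (simp add: UNIV_option_conv sum.reindex \<phi>_def cong: if_cong)
      also have "(\<Sum>m\<in>UNIV. c (Some m) * (if j = m then u $ k else 0)) = c (Some j) * u $ k"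
        by (simp add: if_distrib cong: if_cong)
      finally show ?thesis using c by simp
    qed
    \<comment> \<open>Off-diagonal entries of row \<open>k\<close> kill \<open>c (Some j)\<close>
      for \<open>j \<noteq> k\<close>; the diagonal entry at such a \<open>j\<close> then kills
      \<open>c None\<close>, and the entry at \<open>(k, k)\<close> the last coefficient.\<close>
    obtain k where k: "u $ k \<noteq> 0" using assms by (auto simp: vec_eq_iff)
    have *: "c (Some j) = 0" if "j \<noteq> k" for j using eq[of k j] k that by simp
    obtain j where "j \<noteq> k" by (cases "k = 1") (auto intro: that[of 1] that[of 2])
    then have N: "c None = 0" using eq[of j j] * by simp
    then have "c (Some k) = 0" using eq[of k k] k by simp
    with * have "c (Some j) = 0" for j by (cases "j = k") auto
    with N have "c b = 0" for b by (cases b) auto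
    then show "\<forall>b\<in>UNIV. c b = 0" by simp
  qed simp
  then show ?thesis using rank_nullity[OF det_form.linear_axioms, of u] by (simp add: card_UNIV_option)
qed

section \<open>Points of X and their linear spans\<close>

definition rank_one :: "complex ^ 3 \<Rightarrow> complex ^ 'n \<Rightarrow> complex ^ (3 \<times> 'n \<times> 'n::finite)" where
  "rank_one u v = (\<chi> p. case p of (i, a, b) \<Rightarrow> u $ i * v $ a * v $ b)"

definition outer :: "complex ^ 'n::finite \<Rightarrow> complex ^ (3 \<times> 3) \<Rightarrow> complex ^ ('n \<times> 3 \<times> 3)" where
  "outer v S = (\<chi> p. v $ fst p * S $ snd p)"

interpretation outer: Vector_Spaces.linear "(*s)" "(*s)" "outer v" for v
  by unfold_locales (auto simp: vec_eq_iff outer_def algebra_simps)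

text \<open>Contraction with one factor \<open>v\<close> reduces \<open>M\<close> to a 3 by 3
  matrix, pairing with \<open>u\<close> makes a quadratic form of it, and the other factor
  \<open>v\<close> is the value. So the range has dimension at most that of
  \<open>det_form u\<close>.\<close>

lemma quad_coeffs_rank_one:
  "quad_coeffs (rank_one u v) M = outer v (det_form u (\<chi> q. \<Sum>b\<in>UNIV. v $ b * M $ (b, q)))"
  by (simp add: vec_eq_iff quad_coeffs_def rank_one_def outer_def det_form_def contract_def mapply_axis wedge_def
      sum_3 sum.distrib sum_distrib_left sum_distrib_right sum_subtractf algebra_simps)

lemma range_quad_coeffs_rank_one:
  assumes "u \<noteq> 0"
  shows "\<exists>B. finite B \<and> card B \<le> 5 \<and> range (quad_coeffs (rank_one u v)) \<subseteq> vec.span B"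
proof -
  obtain B where B: "B \<subseteq> range (det_form u)" "vec.independent B" "range (det_form u) \<subseteq> vec.span B"
    "card B = vec.dim (range (det_form u))"
    by (rule vec.basis_exists)
  have fB: "finite B" using B(2) by (rule vec.finiteI_independent)
  have "range (quad_coeffs (rank_one u v)) \<subseteq> outer v ` range (det_form u)"
    by (auto simp: quad_coeffs_rank_one)
  also have "\<dots> \<subseteq> outer v ` vec.span B" using B(3) by (rule image_mono)
  also have "\<dots> = vec.span (outer v ` B)" by (simp add: outer.span_image)
  finally have "range (quad_coeffs (rank_one u v)) \<subseteq> vec.span (outer v ` B)" .
  moreover have "card (outer v ` B) \<le> 5"
    using card_image_le[OF fB, of "outer v"] B(4) dim_range_det_form[OF assms] by simp
  ultimately show ?thesis using fB by blast
qed

text \<open>\<open>quad_coeffs\<close> is linear in the tensor, so the range for \<open>f\<close>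
  lies in the sum of the ranges for the points of \<open>T\<close>, each spanned by at most 5
  vectors.\<close>

lemma dim_range_quad_coeffs_span:
  assumes T: "T \<subseteq> segre_veronese" "finite T" and f: "f \<in> vec.span T"
  shows "vec.dim (range (quad_coeffs f)) \<le> 5 * card T"
proof -
  have "\<forall>t\<in>T. \<exists>B. finite B \<and> card B \<le> 5 \<and> range (quad_coeffs t) \<subseteq> vec.span B"
  proof
    fix t assume "t \<in> T"
    then obtain u v where "t = rank_one u v" "u \<noteq> 0"
      using T(1) unfolding segre_veronese_def rank_one_def by blast
    then show "\<exists>B. finite B \<and> card B \<le> 5 \<and> range (quad_coeffs t) \<subseteq> vec.span B"
      using range_quad_coeffs_rank_one by metis
  qed
  then obtain B where B: "\<And>t. t \<in> T \<Longrightarrow> finite (B t) \<and> card (B t) \<le> 5 \<and> range (quad_coeffs t) \<subseteq> vec.span (B t)"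
    by metis
  obtain c where c: "f = (\<Sum>t\<in>T. c t *s t)" using f vec.span_finite[OF T(2)] by auto
  have "range (quad_coeffs f) \<subseteq> vec.span (\<Union>t\<in>T. B t)"
  proof clarify
    fix M
    have "quad_coeffs t M \<in> vec.span (\<Union>t\<in>T. B t)" if "t \<in> T" for t
      using B[OF that] vec.span_mono[of "B t" "\<Union>t\<in>T. B t"] that by blast
    then show "quad_coeffs f M \<in> vec.span (\<Union>t\<in>T. B t)"
      unfolding c quad_coeffs_left.sum quad_coeffs_left.scale
      by (intro vec.span_sum vec.span_scale)
  qed
  then show ?thesis using B T(2) by (intro dim_span_Union_le) auto
qed

section \<open>Symmetry and bounded rank as closed conditions on tensors\<close>

definition sym_tensor :: "complex ^ (3 \<times> 'n \<times> 'n::finite) \<Rightarrow> bool" where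
  "sym_tensor f \<longleftrightarrow> (\<forall>i a b. f $ (i, a, b) = f $ (i, b, a))"

text \<open>The closure in \<open>secant\<close> is taken among all tensors, so symmetry, on which
  \<open>tens_injective\<close> rests, is carried along with the rank bound.\<close>

lemma sym_tensor_span:
  assumes "T \<subseteq> segre_veronese" "f \<in> vec.span T"
  shows "sym_tensor f"
  using assms(2)
proof (induction rule: vec.span_induct_alt)
  case (step c x y)
  have "sym_tensor x" using step(1) assms(1) by (auto simp: segre_veronese_def sym_tensor_def)
  then show ?case using step by (simp add: sym_tensor_def)
qed (simp add: sym_tensor_def)

lemma linear_range_subset_span:
  fixes \<phi> :: "'a::field ^ 'm \<Rightarrow> 'a ^ 'k"
  assumes "Vector_Spaces.linear (*s) (*s) \<phi>"
  shows "range \<phi> \<subseteq> vec.span (range (\<lambda>i. \<phi> (axis i 1)))"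
proof clarify
  interpret \<phi>: Vector_Spaces.linear "(*s)" "(*s)" \<phi> by fact
  fix x
  have "\<phi> x = \<phi> (\<Sum>i\<in>UNIV. x $ i *s axis i 1)" by (simp add: basis_expansion)
  also have "\<dots> = (\<Sum>i\<in>UNIV. x $ i *s \<phi> (axis i 1))" by (simp only: \<phi>.sum \<phi>.scale)
  also have "\<dots> \<in> vec.span (range (\<lambda>i. \<phi> (axis i 1)))"
    by (intro vec.span_sum vec.span_scale vec.span_base) auto
  finally show "\<phi> x \<in> vec.span (range (\<lambda>i. \<phi> (axis i 1)))" .
qed

text \<open>Passes from a linear map to the finite family of its values on the standard basis, as
  \<open>dim_le_iff_minors_vanish\<close> requires.\<close>

lemma dim_range_linear:
  fixes \<phi> :: "'a::field ^ 'm \<Rightarrow> 'a ^ 'k"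
  assumes "Vector_Spaces.linear (*s) (*s) \<phi>"
  shows "vec.dim (range \<phi>) = vec.dim (range (\<lambda>i. \<phi> (axis i 1)))"
proof (rule antisym)
  show "vec.dim (range \<phi>) \<le> vec.dim (range (\<lambda>i. \<phi> (axis i 1)))"
    using vec.dim_subset[OF linear_range_subset_span[OF assms]] by simp
  show "vec.dim (range (\<lambda>i. \<phi> (axis i 1))) \<le> vec.dim (range \<phi>)"
    by (rule vec.dim_subset) auto
qed

lemma zclosed_quad_coeffs:
  "zclosed {f :: complex ^ (3 \<times> 'n \<times> 'n::finite). f \<noteq> 0 \<and> sym_tensor f \<and> vec.dim (range (quad_coeffs f)) \<le> d}"
proof -
  define D where "D J c f = det (\<chi> i. if i \<in> J then quad_coeffs f (axis i 1) else c i)"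
    for J c and f :: "complex ^ (3 \<times> 'n \<times> 'n)"
  define P where "P = (\<lambda>(J, c). D J c) ` {(J, c). card J = Suc d} \<union>
    range (\<lambda>(i :: 3, a :: 'n, b) f. f $ (i, a, b) - f $ (i, b, a))"
  \<comment> \<open>Rows in \<open>J\<close> are linear in \<open>f\<close> and the others constant,
    so the determinant is a form of degree \<open>card J\<close>.\<close>
  have "form (\<Sum>i\<in>UNIV. if i \<in> J then 1 else 0) (D J c)" for J c
    unfolding D_def
  proof (rule form_det)
    fix i j
    show "form (if i \<in> J then 1 else 0)
      (\<lambda>x. (\<chi> i. if i \<in> J then quad_coeffs x (axis i 1) else c i) $ i $ j)"
      using form_linear[OF quad_coeffs_left.linear_axioms, of "axis i 1" j] form.const[of "c i $ j"]
      by (cases "i \<in> J") simp_all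
  qed
  moreover have "\<exists>d. form d (\<lambda>f :: complex ^ (3 \<times> 'n \<times> 'n). f $ i - f $ j)" for i j
    by (rule exI, rule form_diff[OF form_coord form_coord])
  ultimately have "\<forall>p\<in>P. \<exists>d. form d p" unfolding P_def by auto
  moreover have "sym_tensor f \<and> vec.dim (range (quad_coeffs f)) \<le> d \<longleftrightarrow> (\<forall>p\<in>P. p f = 0)" for f
    unfolding dim_range_linear[OF quad_coeffs_right.linear_axioms] dim_le_iff_minors_vanish
    by (simp add: P_def D_def sym_tensor_def ball_Un) blast
  ultimately show ?thesis unfolding zclosed_def by auto
qed

lemma secant_rank_le:
  fixes f :: "complex ^ (3 \<times> 'n \<times> 'n::finite)"
  assumes "f \<in> secant k"
  shows "sym_tensor f" "vec.dim (range (quad_coeffs f)) \<le> 5 * k"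
proof -
  have "secant k \<subseteq> {f :: complex ^ (3 \<times> 'n \<times> 'n). f \<noteq> 0 \<and> sym_tensor f \<and> vec.dim (range (quad_coeffs f)) \<le> 5 * k}"
    unfolding secant_def
    by (rule hull_minimal) (auto simp: sym_tensor_span dim_range_quad_coeffs_span zclosed_quad_coeffs)
  then show "sym_tensor f" "vec.dim (range (quad_coeffs f)) \<le> 5 * k" using assms by auto
qed

section \<open>Sections of the monad and of its cohomology\<close>

lemma upper_V_Omega2: "w \<in> upper V_Omega2 x \<longleftrightarrow> (\<forall>a. (\<Sum>i\<in>UNIV. w $ (a, i) * x $ i) = 0)"
  by (simp add: V_Omega2_def)

lemma V_Omega2_simps: "lower V_Omega2 x = {0}" "twist V_Omega2 = 1"
  by (simp_all add: V_Omega2_def)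

lemma wedge_upper: "wedge w x \<in> upper V_Omega2 x"
  by (simp add: upper_V_Omega2 wedge_def sum_3 algebra_simps)

lemma dual_vector:
  fixes x :: "complex ^ 3"
  assumes "x \<noteq> 0"
  obtains u :: "complex ^ 3" where "u $ 1 * x $ 1 + u $ 2 * x $ 2 + u $ 3 * x $ 3 = 1"
proof -
  obtain k where k: "x $ k \<noteq> 0" using assms by (auto simp: vec_eq_iff)
  have "(\<Sum>i\<in>UNIV. axis k (inverse (x $ k)) $ i * x $ i) = 1"
    using k by (simp add: axis_def if_distrib if_distribR cong: if_cong)
  then show ?thesis using that[of "axis k (inverse (x $ k))"] by (simp add: sum_3)
qed

text \<open>Choose \<open>u\<close> with u.x = 1. Since v.x = 0, the triple product (u \<times> v)
  \<times> x = (u.x) v - (v.x) u equals v, row by row.\<close>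

lemma upper_eq_wedge:
  assumes "x \<noteq> 0" "v \<in> upper V_Omega2 x"
  obtains w where "v = wedge w x"
proof -
  obtain u :: "complex ^ 3" where u: "u $ 1 * x $ 1 + u $ 2 * x $ 2 + u $ 3 * x $ 3 = 1"
    using dual_vector[OF assms(1)] .
  define w :: "complex ^ ('a \<times> 3)" where "w = (\<chi> p. vprod u (\<chi> i. v $ (fst p, i)) $ snd p)"
  have "v $ (a, i) = wedge w x $ (a, i)" for a i
  proof -
    have v: "v $ (a, 1) * x $ 1 + v $ (a, 2) * x $ 2 + v $ (a, 3) * x $ 3 = 0"
      using assms(2) by (simp add: upper_V_Omega2 sum_3)
    have "v $ (a, 1) = (u $ 3 * v $ (a, 1) - u $ 1 * v $ (a, 3)) * x $ 3 - (u $ 1 * v $ (a, 2) - u $ 2 * v $ (a, 1)) * x $ 2"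
      "v $ (a, 2) = (u $ 1 * v $ (a, 2) - u $ 2 * v $ (a, 1)) * x $ 1 - (u $ 2 * v $ (a, 3) - u $ 3 * v $ (a, 2)) * x $ 3"
      "v $ (a, 3) = (u $ 2 * v $ (a, 3) - u $ 3 * v $ (a, 2)) * x $ 2 - (u $ 3 * v $ (a, 1) - u $ 1 * v $ (a, 3)) * x $ 1"
      using u v by algebra+
    then show ?thesis
      using exhaust_3[of i] by (auto simp only: w_def wedge_def vprod_nth vec_lambda_beta fst_conv snd_conv)
  qed
  then have "v = wedge w x" by (simp add: vec_eq_iff)
  then show ?thesis by (rule that)
qed

text \<open>With u.x = 1, the identity u \<times> (w \<times> x) = (u.x) w - (u.w) x gives w = (u.w)
  x in each row.\<close>

lemma wedge_eq_0:
  assumes "x \<noteq> 0" "wedge w x = 0"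
  obtains l where "w = tens l x"
proof -
  obtain u :: "complex ^ 3" where u: "u $ 1 * x $ 1 + u $ 2 * x $ 2 + u $ 3 * x $ 3 = 1"
    using dual_vector[OF assms(1)] .
  define l where "l = (\<chi> a. u $ 1 * w $ (a, 1) + u $ 2 * w $ (a, 2) + u $ 3 * w $ (a, 3))"
  have "w $ (a, i) = tens l x $ (a, i)" for a i
  proof -
    have "wedge w x $ (a, j) = 0" for j using assms(2) by simp
    from this[of 1] this[of 2] this[of 3]
    have "w $ (a, 2) * x $ 3 = w $ (a, 3) * x $ 2" "w $ (a, 3) * x $ 1 = w $ (a, 1) * x $ 3"
      "w $ (a, 1) * x $ 2 = w $ (a, 2) * x $ 1"
      by (simp_all add: wedge_def)
    with u have "w $ (a, 1) = (u $ 1 * w $ (a, 1) + u $ 2 * w $ (a, 2) + u $ 3 * w $ (a, 3)) * x $ 1"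
      "w $ (a, 2) = (u $ 1 * w $ (a, 1) + u $ 2 * w $ (a, 2) + u $ 3 * w $ (a, 3)) * x $ 2"
      "w $ (a, 3) = (u $ 1 * w $ (a, 1) + u $ 2 * w $ (a, 2) + u $ 3 * w $ (a, 3)) * x $ 3"
      by algebra+
    then show ?thesis
      using exhaust_3[of i] by (auto simp only: l_def tens_def vec_lambda_beta fst_conv snd_conv)
  qed
  then have "w = tens l x" by (simp add: vec_eq_iff)
  then show ?thesis by (rule that)
qed

lemma lin_coeffs_eq_0_iff: "lin_coeffs f w = 0 \<longleftrightarrow> (\<forall>x. x \<noteq> 0 \<longrightarrow> contract f (wedge w x) = 0)"
proof
  assume *: "\<forall>x. x \<noteq> 0 \<longrightarrow> contract f (wedge w x) = 0"
  have "contract f (wedge w (axis j 1)) = 0" for j using * by (simp add: axis_eq_0_iff)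
  then show "lin_coeffs f w = 0" by (simp add: vec_eq_iff lin_coeffs_def)
qed (simp add: vec_eq_iff contract_wedge)

text \<open>For symmetric \<open>f\<close>, the evaluation \<open>I \<otimes> \<O> \<rightarrow> V\<^sup>\<or> \<otimes> \<Omega>\<^sup>1(2)\<close> is dual to \<open>f\<close>, so that
  surjectivity of \<open>f\<close> makes it injective on fibres.\<close>

lemma tens_injective:
  assumes surj: "monad_surj f" and sym: "sym_tensor f" and x: "x \<noteq> 0"
    and l: "lin_coeffs f (tens l x) = 0"
  shows "l = 0"
proof -
  have pairing: "(\<Sum>a\<in>UNIV. l $ a * contract f w $ a) = 0" if w: "w \<in> upper V_Omega2 x" for w
  proof -
    obtain v where v: "w = wedge v x" using upper_eq_wedge[OF x w] .
    \<comment> \<open>Anticommutativity of the cross product: \<open>l\<close> and \<open>x\<close>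
      move into the first factor, and row \<open>b\<close> of \<open>v\<close> becomes the point of
      evaluation.\<close>
    have adj: "l $ a * wedge v x $ (b, i) = - wedge (tens l x) (\<chi> i. v $ (b, i)) $ (a, i)" for a b i
      using exhaust_3[of i] by (elim disjE; simp add: wedge_def tens_def algebra_simps)
    have "(\<Sum>a\<in>UNIV. l $ a * contract f w $ a) =
        (\<Sum>a\<in>UNIV. \<Sum>i\<in>UNIV. \<Sum>b\<in>UNIV. f $ (i, a, b) * (l $ a * wedge v x $ (b, i)))"
      by (simp add: contract_def v sum_distrib_left mult_ac)
    also have "\<dots> = (\<Sum>i\<in>UNIV. \<Sum>b\<in>UNIV. \<Sum>a\<in>UNIV. f $ (i, a, b) * (l $ a * wedge v x $ (b, i)))"
      by (subst sum.swap, rule sum.cong[OF refl], subst sum.swap) (rule refl)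
    \<comment> \<open>Symmetry of \<open>f\<close> exchanges the two \<open>V\<close>-indices, so
      that the sum over \<open>a\<close> becomes a contraction with \<open>tens l x\<close>.\<close>
    also have "\<dots> = (\<Sum>b\<in>UNIV. \<Sum>i\<in>UNIV. \<Sum>a\<in>UNIV. f $ (i, b, a) * (l $ a * wedge v x $ (b, i)))"
      using sym by (subst sum.swap) (simp add: sym_tensor_def)
    also have "\<dots> = (\<Sum>b\<in>UNIV. - contract f (wedge (tens l x) (\<chi> i. v $ (b, i))) $ b)"
      unfolding adj by (simp add: contract_def sum_negf)
    also have "\<dots> = 0" by (simp add: contract_wedge l)
    finally show ?thesis .
  qed
  have "l $ a = 0" for a
  proof -
    have "axis a 1 \<in> contract f ` upper V_Omega2 x"
      using surj x by (auto simp: monad_surj_def V_O1_def)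
    then obtain w where w: "w \<in> upper V_Omega2 x" "contract f w = axis a 1" by force
    have "(\<Sum>b\<in>UNIV. l $ b * axis a 1 $ b) = 0" using pairing[OF w(1)] unfolding w(2) .
    then show "l $ a = 0" by (simp add: axis_def if_distrib cong: if_cong)
  qed
  then show ?thesis by (simp add: vec_eq_iff)
qed

lemma wedge_section: "wedge w \<in> sections plane V_Omega2 0"
proof -
  have "regular plane 1 (\<lambda>x. wedge w x $ i)" for i
    using form_regular[OF form_linear[OF wedge_right.linear_axioms]] by simp
  then show ?thesis
    unfolding sections_def
    by (auto intro!: exI[of _ plane] exI[of _ "wedge w"] zopen_plane wedge_upper simp: V_Omega2_simps)
qed

text \<open>All coordinates are linear forms by \<open>regular_1_linear\<close>. Vanishing at
  \<open>x\<close>, tested at basis vectors and at sums of two of them, makes each row a skew 3 by 3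
  matrix, that is, a cross product with a fixed vector.\<close>

lemma sections_V_Omega2:
  fixes \<omega> :: "complex ^ 3 \<Rightarrow> complex ^ ('n::finite \<times> 3)"
  assumes "\<omega> \<in> sections plane V_Omega2 0"
  obtains w where "\<And>x. x \<noteq> 0 \<Longrightarrow> \<omega> x = wedge w x"
proof -
  have loc: "\<exists>D k. zopen D \<and> x \<in> D \<and> (\<forall>p. regular D 1 (\<lambda>y. k y $ p)) \<and>
      (\<forall>y\<in>D. k y \<in> upper V_Omega2 y \<and> \<omega> y = k y)" if "x \<noteq> 0" for x
  proof -
    have "x \<in> plane" using that by simp
    from assms[unfolded sections_def V_Omega2_simps, THEN CollectD, rule_format, OF this]
    obtain D k where "zopen D" "x \<in> D" "\<forall>i. regular D (1 + 0) (\<lambda>y. k y $ i)"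
      "\<forall>y\<in>D. k y \<in> upper V_Omega2 y \<and> \<omega> y - k y \<in> {0}"
      by blast
    then show ?thesis by (intro exI[of _ D] exI[of _ k]) simp
  qed
  have "\<exists>c. \<forall>x. x \<noteq> 0 \<longrightarrow> \<omega> x $ p = (\<Sum>j\<in>UNIV. c j * x $ j)" for p
  proof -
    have "regular plane 1 (\<lambda>x. \<omega> x $ p)"
    proof (rule regular_local)
      fix x :: "complex ^ 3" assume "x \<in> plane"
      then obtain D k where "zopen D" "x \<in> D" "\<forall>p. regular D 1 (\<lambda>y. k y $ p)" "\<forall>y\<in>D. \<omega> y = k y"
        using loc[of x] by auto
      then show "\<exists>D h'. zopen D \<and> x \<in> D \<and> regular D 1 h' \<and> (\<forall>y\<in>D. \<omega> y $ p = h' y)"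
        by (intro exI[of _ D] exI[of _ "\<lambda>y. k y $ p"]) (cases p, auto)
    qed
    then obtain c where "\<And>x. x \<noteq> 0 \<Longrightarrow> \<omega> x $ p = (\<Sum>j\<in>UNIV. c j * x $ j)"
      using regular_1_linear by blast
    then show ?thesis by blast
  qed
  then obtain c where c: "\<And>p x. x \<noteq> 0 \<Longrightarrow> \<omega> x $ p = (\<Sum>j\<in>UNIV. c p j * x $ j)" by metis
  have up: "(\<Sum>i\<in>UNIV. (\<Sum>j\<in>UNIV. c (a, i) j * x $ j) * x $ i) = 0" if "x \<noteq> 0" for a x
  proof -
    have "\<omega> x \<in> upper V_Omega2 x" using loc[OF that] by auto
    then show ?thesis by (simp add: upper_V_Omega2 c[OF that])
  qed
  have diag: "c (a, i) i = 0" for a i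
  proof -
    have "axis i 1 \<noteq> (0 :: complex ^ 3)" by (simp add: axis_eq_0_iff)
    from up[OF this, of a] show ?thesis using exhaust_3[of i] by (auto simp: sum_3 axis_def)
  qed
  have skew: "c (a, i) j = - c (a, j) i" if "i \<noteq> j" for a i j
  proof -
    have "axis i 1 + axis j 1 \<noteq> (0 :: complex ^ 3)" using that by (auto simp: vec_eq_iff axis_def)
    from up[OF this, of a] show ?thesis
      using diag[of a] that exhaust_3[of i] exhaust_3[of j]
      by (auto simp: sum_3 axis_def eq_neg_iff_add_eq_0 add.commute)
  qed
  define w :: "complex ^ ('n \<times> 3)" where
    "w = (\<chi> p. if snd p = 1 then c (fst p, 3) 2 else if snd p = 2 then c (fst p, 1) 3 else c (fst p, 2) 1)"
  have "\<omega> x = wedge w x" if "x \<noteq> 0" for x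
  proof -
    have "\<omega> x $ (a, i) = wedge w x $ (a, i)" for a i
      using exhaust_3[of i] skew[of 2 3 a] skew[of 3 1 a] skew[of 1 2 a]
      by (elim disjE; simp add: c[OF that] diag sum_3 w_def wedge_def)
    then show ?thesis by (simp add: vec_eq_iff)
  qed
  then show ?thesis by (rule that)
qed

section \<open>The space I and the fibres of its image\<close>

lemma rank_H0_le: "rank_H0 f \<le> enat (vec.dim (range (lin_coeffs f)))"
  unfolding rank_H0_def dim_mod_def
proof (rule SUP_least, clarify)
  fix B assume B: "finite B" "B \<subseteq> (\<lambda>\<omega> x. contract f (\<omega> x)) ` sections plane V_Omega2 0"
    and ind: "\<forall>c. (\<lambda>x. \<Sum>b\<in>B. c b *s b x) \<in> null_sections plane V_O1 \<longrightarrow> (\<forall>b\<in>B. c b = 0)"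
  have "\<forall>b\<in>B. \<exists>w. \<forall>x. x \<noteq> 0 \<longrightarrow> b x = contract f (wedge w x)"
  proof
    fix b assume "b \<in> B"
    then obtain \<omega> where \<omega>: "\<omega> \<in> sections plane V_Omega2 0" "b = (\<lambda>x. contract f (\<omega> x))" using B(2) by blast
    obtain w where "\<And>x. x \<noteq> 0 \<Longrightarrow> \<omega> x = wedge w x" using sections_V_Omega2[OF \<omega>(1)] by blast
    then show "\<exists>w. \<forall>x. x \<noteq> 0 \<longrightarrow> b x = contract f (wedge w x)" using \<omega>(2) by auto
  qed
  then obtain W where W: "\<And>b x. b \<in> B \<Longrightarrow> x \<noteq> 0 \<Longrightarrow> b x = contract f (wedge (W b) x)" by metis
  have "card B \<le> vec.dim (range (lin_coeffs f))"
  proof (rule card_le_dim_of_independent_family[OF B(1), of "\<lambda>b. lin_coeffs f (W b)"])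
    fix c assume "(\<Sum>b\<in>B. c b *s lin_coeffs f (W b)) = 0"
    then have 0: "lin_coeffs f (\<Sum>b\<in>B. c b *s W b) = 0" by (simp add: lin_coeffs.sum lin_coeffs.scale)
    have "(\<Sum>b\<in>B. c b *s b x) = 0" if x: "x \<noteq> 0" for x
    proof -
      have "(\<Sum>b\<in>B. c b *s b x) = contract f (wedge (\<Sum>b\<in>B. c b *s W b) x)"
        using W x by (simp add: wedge_left.sum wedge_left.scale contract_right.sum contract_right.scale)
      then show ?thesis using 0 x by (simp add: lin_coeffs_eq_0_iff)
    qed
    then show "\<forall>b\<in>B. c b = 0" using ind by (simp add: null_sections_def V_O1_def)
  qed auto
  then show "enat (card B) \<le> enat (vec.dim (range (lin_coeffs f)))" by simp
qed

text \<open>Every global section is some \<open>wedge w\<close> on the plane, so I becomes the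
  kernel of \<open>lin_coeffs f\<close>.\<close>

lemma lower_monad_bundle:
  assumes x: "x \<noteq> 0"
  shows "lower (monad_bundle f) x = {wedge w x | w. lin_coeffs f w = 0}"
proof (intro equalityI subsetI)
  fix v assume "v \<in> lower (monad_bundle f) x"
  then obtain \<omega> where \<omega>: "\<omega> \<in> ker_H0 f" "v = \<omega> x" by (auto simp: monad_bundle_def)
  then obtain w where w: "\<And>x. x \<noteq> 0 \<Longrightarrow> \<omega> x = wedge w x"
    using sections_V_Omega2[of \<omega>] by (auto simp: ker_H0_def)
  have "lin_coeffs f w = 0"
    using \<omega>(1) w by (simp add: lin_coeffs_eq_0_iff ker_H0_def null_sections_def V_O1_def)
  then show "v \<in> {wedge w x | w. lin_coeffs f w = 0}" using \<omega>(2) w[OF x] by blast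
next
  fix v assume "v \<in> {wedge w x | w. lin_coeffs f w = 0}"
  then obtain w where w: "v = wedge w x" "lin_coeffs f w = 0" by blast
  have "wedge w \<in> ker_H0 f"
    using w(2) by (simp add: ker_H0_def wedge_section null_sections_def V_O1_def lin_coeffs_eq_0_iff)
  then show "v \<in> lower (monad_bundle f) x" using w(1) by (auto simp: monad_bundle_def)
qed

lemma lin_coeffs_tens_linear: "Vector_Spaces.linear (*s) (*s) (\<lambda>x. lin_coeffs f (tens l x))"
  by unfold_locales (simp_all add: tens_right.add tens_right.scale lin_coeffs.add lin_coeffs.scale)

lemma lin_coeffs_mapply_linear: "Vector_Spaces.linear (*s) (*s) (\<lambda>x. lin_coeffs f (mapply M x))"
  by unfold_locales (simp_all add: mapply_right.add mapply_right.scale lin_coeffs.add lin_coeffs.scale)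

text \<open>A quadratic section of the kernel that lies in the image of \<open>I \<otimes> \<O>\<close> comes from
  \<open>I \<otimes> H\<^sup>0(\<O>(1))\<close>: the scalars \<open>l x\<close> below are given by Cramer's rule, hence regular of degree 0.\<close>

lemma null_quad:
  fixes f :: "complex ^ (3 \<times> 'n \<times> 'n::finite)"
  assumes surj: "monad_surj f" and sym: "sym_tensor f"
    and null: "\<And>x. x \<noteq> 0 \<Longrightarrow> quad M x \<in> lower (monad_bundle f) x"
  obtains l where "\<And>x. lin_coeffs f (mapply M x - tens l x) = 0"
proof -
  have "\<exists>l. lin_coeffs f (mapply M x - tens l x) = 0" if x: "x \<noteq> 0" for x
  proof -
    obtain w where w: "quad M x = wedge w x" "lin_coeffs f w = 0"
      using null[OF x] lower_monad_bundle[OF x, of f] by blast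
    have "wedge (mapply M x - w) x = 0" using w(1) by (simp add: quad_def wedge_left.diff)
    then obtain l where "mapply M x - w = tens l x" using wedge_eq_0[OF x] by blast
    then have "mapply M x - tens l x = w" by (simp add: algebra_simps)
    then show ?thesis using w(2) by metis
  qed
  then obtain l where "\<And>x. x \<noteq> 0 \<Longrightarrow> lin_coeffs f (mapply M x - tens (l x) x) = 0" by metis
  then have l: "lin_coeffs f (tens (l x) x) = lin_coeffs f (mapply M x)" if "x \<noteq> 0" for x
    using that by (simp add: lin_coeffs.diff)
  have "regular plane 0 (\<lambda>x. l x $ k)" for k
    unfolding regular_def
  proof
    define H where "H x = matrix (\<lambda>v. lin_coeffs f (tens v x))" for x
    have H: "H x *v v = lin_coeffs f (tens v x)" for x v
    proof -
      have "Vector_Spaces.linear (*s) (*s) (\<lambda>v. lin_coeffs f (tens v x))"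
        by unfold_locales (simp_all add: tens_left.add tens_left.scale lin_coeffs.add lin_coeffs.scale)
      then show ?thesis unfolding H_def by (rule matrix_works)
    qed
    fix x0 :: "complex ^ 3" assume "x0 \<in> plane"
    then have "inj ((*v) (H x0))"
      using tens_injective[OF surj sym] by (simp add: vec.inj_iff_eq_0 H)
    \<comment> \<open>The system for \<open>l x\<close> is overdetermined; the constant matrix
      \<open>A\<close> makes it square, with determinant 1 at \<open>x0\<close> and hence solvable
      by Cramer's rule wherever \<open>q\<close> is nonzero.\<close>
    then obtain A where A: "A ** H x0 = mat 1" using matrix_left_invertible_injective by blast
    define p where "p x = det (\<chi> i j. if j = k then (A *v lin_coeffs f (mapply M x)) $ i else (A ** H x) $ i $ j)" for x
    define q where "q x = det (A ** H x)" for x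
    have fH: "form 1 (\<lambda>x. (A ** H x) $ i $ j)" for i j
    proof -
      have "(A ** H x) $ i $ j = (\<Sum>m\<in>UNIV. A $ i $ m * lin_coeffs f (tens (axis j 1) x) $ m)" for x
        by (simp add: matrix_matrix_mult_def H_def matrix_def)
      then show ?thesis
        by (simp only:) (intro form_sum form_cmult form_linear[OF lin_coeffs_tens_linear])
    qed
    have fb: "form 1 (\<lambda>x. (A *v lin_coeffs f (mapply M x)) $ i)" for i
      unfolding matrix_vector_mult_def
      by (simp only: vec_lambda_beta) (intro form_sum form_cmult form_linear[OF lin_coeffs_mapply_linear])
    \<comment> \<open>Numerator and denominator have the same degree \<open>CARD('n)\<close>, one
      for each row, so the quotient has degree 0.\<close>
    have "form (\<Sum>i\<in>(UNIV :: 'n set). 1) p"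
      unfolding p_def
    proof (rule form_det)
      fix i j
      show "form 1 (\<lambda>x. (\<chi> i j. if j = k then (A *v lin_coeffs f (mapply M x)) $ i else (A ** H x) $ i $ j) $ i $ j)"
        using fH[of i j] fb[of i] by (cases "j = k") simp_all
    qed
    moreover have "form (\<Sum>i\<in>(UNIV :: 'n set). 1) q"
      unfolding q_def by (rule form_det) (rule fH)
    moreover have "q x0 \<noteq> 0" by (simp add: q_def A)
    moreover have "l x $ k = p x / q x" if x: "x \<in> plane" "q x \<noteq> 0" for x
    proof -
      have "(A ** H x) *v l x = A *v lin_coeffs f (mapply M x)"
        using x l by (simp add: matrix_vector_mul_assoc[symmetric] H)
      then have "l x = (\<chi> k. det (\<chi> i j. if j = k then (A *v lin_coeffs f (mapply M x)) $ i else (A ** H x) $ i $ j) / det (A ** H x))"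
        using x cramer[of "A ** H x"] by (simp add: q_def)
      from arg_cong[OF this, of "\<lambda>v. v $ k"] show ?thesis by (simp only: p_def q_def vec_lambda_beta)
    qed
    ultimately show "\<exists>i j p q. form i p \<and> form j q \<and> int i - int j = 0 \<and> q x0 \<noteq> 0 \<and>
        (\<forall>y\<in>plane. q y \<noteq> 0 \<longrightarrow> l y $ k = p y / q y)"
      by (intro exI[of _ "\<Sum>i\<in>(UNIV :: 'n set). 1"] exI[of _ p] exI[of _ q]) simp
  qed
  then have const: "l x = l (axis 1 1)" if "x \<noteq> 0" for x
    using regular_0_constant that by (metis (mono_tags, lifting) axis_eq_0_iff vec_eq_iff zero_neq_one)
  have "lin_coeffs f (mapply M x - tens (l (axis 1 1)) x) = 0" for x
  proof (cases "x = 0")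
    case False
    then show ?thesis using l[OF False] const[OF False] by (simp add: lin_coeffs.diff)
  qed (simp add: mapply_right.zero tens_right.zero lin_coeffs.zero)
  then show ?thesis by (rule that)
qed

section \<open>Quadratic sections that become zero in E(1)\<close>

definition column_mat :: "3 \<Rightarrow> complex ^ ('n::finite \<times> 3) \<Rightarrow> complex ^ ('n \<times> 3 \<times> 3)" where
  "column_mat j w = (\<chi> p. if snd (snd p) = j then w $ (fst p, fst (snd p)) else 0)"

text \<open>The matrices with \<open>mapply (scalar_mat l) x = tens l x\<close>, whose quadratic
  section is zero; \<open>column_mat j w\<close> stands for \<open>x $ j\<close> times the section
  \<open>wedge w\<close>.\<close>

definition scalar_mat :: "complex ^ 'n::finite \<Rightarrow> complex ^ ('n \<times> 3 \<times> 3)" where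
  "scalar_mat l = (\<chi> p. if fst (snd p) = snd (snd p) then l $ fst p else 0)"

interpretation column_mat: Vector_Spaces.linear "(*s)" "(*s)" "column_mat j" for j
  by unfold_locales (auto simp: vec_eq_iff column_mat_def)

interpretation scalar_mat: Vector_Spaces.linear "(*s)" "(*s)" scalar_mat
  by unfold_locales (auto simp: vec_eq_iff scalar_mat_def)

lemma mat_decomposition:
  "M = (\<Sum>j\<in>UNIV. column_mat j (mapply M (axis j 1) - tens l (axis j 1))) + scalar_mat l"
proof -
  have "M $ (a, i, k) = ((\<Sum>j\<in>UNIV. column_mat j (mapply M (axis j 1) - tens l (axis j 1))) + scalar_mat l) $ (a, i, k)"
    for a i k
    unfolding mapply_axis using exhaust_3[of i] exhaust_3[of k]
    by (auto simp: sum_3 column_mat_def scalar_mat_def tens_def axis_def)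
  then show ?thesis by (simp add: vec_eq_iff)
qed

text \<open>After subtraction of the scalar part from \<open>null_quad\<close>, all three columns of
  \<open>M\<close> lie in the kernel of \<open>lin_coeffs f\<close>. The columns account for the
  term with factor 3, the scalar matrices for \<open>CARD('n)\<close>.\<close>

lemma dim_null_quad:
  fixes f :: "complex ^ (3 \<times> 'n \<times> 'n::finite)"
  assumes "monad_surj f" "sym_tensor f"
  shows "vec.dim {M. \<forall>x. x \<noteq> 0 \<longrightarrow> quad M x \<in> lower (monad_bundle f) x}
    \<le> 3 * vec.dim {w. lin_coeffs f w = 0} + CARD('n)" (is "vec.dim ?N0 \<le> 3 * vec.dim ?I + _")
proof -
  obtain B where B: "B \<subseteq> ?I" "vec.independent B" "?I \<subseteq> vec.span B" "card B = vec.dim ?I"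
    by (rule vec.basis_exists)
  have fB: "finite B" using B(2) by (rule vec.finiteI_independent)
  define W where "W = (\<Union>j. column_mat j ` B) \<union> range (\<lambda>a. scalar_mat (axis a 1))"
  have "?N0 \<subseteq> vec.span W"
  proof
    fix M assume "M \<in> ?N0"
    then obtain l where l: "\<And>x. lin_coeffs f (mapply M x - tens l x) = 0"
      using null_quad[OF assms] by blast
    have "column_mat j w \<in> vec.span W" if "w \<in> ?I" for j w
    proof -
      have "column_mat j w \<in> column_mat j ` vec.span B" using that B(3) by blast
      also have "\<dots> = vec.span (column_mat j ` B)" by (simp add: column_mat.span_image)
      also have "\<dots> \<subseteq> vec.span W" by (rule vec.span_mono) (auto simp: W_def)
      finally show ?thesis .
    qed
    moreover have "scalar_mat l \<in> vec.span W"
      using linear_range_subset_span[OF scalar_mat.linear_axioms]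
        vec.span_mono[of "range (\<lambda>a. scalar_mat (axis a 1))" W] by (auto simp: W_def)
    ultimately show "M \<in> vec.span W"
      using l by (subst mat_decomposition[of M l]) (intro vec.span_add vec.span_sum; simp)
  qed
  moreover have fW: "finite W" using fB by (simp add: W_def)
  ultimately have "vec.dim ?N0 \<le> card W" by (rule vec.dim_le_card)
  also have "\<dots> \<le> card (\<Union>j. column_mat j ` B) + card (range (\<lambda>a::'n. scalar_mat (axis a 1)))"
    unfolding W_def by (rule card_Un_le)
  also have "\<dots> \<le> (\<Sum>j\<in>(UNIV :: 3 set). card (column_mat j ` B)) + CARD('n)"
    by (intro add_mono card_UN_le card_image_le) auto
  also have "\<dots> \<le> (\<Sum>j\<in>(UNIV :: 3 set). card B) + CARD('n)"
    by (intro add_mono sum_mono card_image_le fB) auto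
  finally show ?thesis using B(4) by simp
qed

lemma form_quad: "form 2 (\<lambda>x. quad M x $ p)"
proof -
  have *: "form 2 (\<lambda>x. mapply M x $ a * x $ i - mapply M x $ b * x $ j)" for a b i j
    using form_mult[OF form_linear[OF mapply_right.linear_axioms] form_coord, of M]
    by (intro form_diff) (simp_all add: numeral_2_eq_2)
  obtain a i where p: "p = (a, i)" by (cases p)
  show ?thesis
    using exhaust_3[of i] by (elim disjE; simp add: p quad_def wedge_def *)
qed

section \<open>The lower bound for h^0(E(1))\<close>

lemma quad_section:
  assumes "quad_coeffs f M = 0"
  shows "quad M \<in> sections plane (monad_bundle f) 1"
proof -
  have "regular plane 2 (\<lambda>x. quad M x $ i)" for i
    using form_regular[OF form_quad] by simp
  moreover have "contract f (quad M x) = 0" for x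
    using contract_quad[of f M x] assms by (simp add: vec_eq_iff)
  moreover have "0 \<in> lower (monad_bundle f) x" if "x \<noteq> 0" for x
    unfolding lower_monad_bundle[OF that] by (intro CollectI exI[of _ 0]) (simp add: wedge_left.zero lin_coeffs.zero)
  ultimately show ?thesis
    unfolding sections_def
    by (intro CollectI ballI exI[of _ plane] exI[of _ "quad M"])
      (auto simp: zopen_plane monad_bundle_def quad_def wedge_upper)
qed

text \<open>A basis of a complement of the null matrices in the kernel of
  \<open>quad_coeffs f\<close> gives sections of E(1) that are independent modulo null
  sections.\<close>

lemma h0_monad_bundle_ge:
  assumes "vec.dim {M. \<forall>x. x \<noteq> 0 \<longrightarrow> quad M x \<in> lower (monad_bundle f) x} + s
    \<le> vec.dim {M. quad_coeffs f M = 0}"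
  shows "enat s \<le> h0 (monad_bundle f) 1"
proof -
  define N where "N = {M. quad_coeffs f M = 0}"
  \<comment> \<open>Intersecting with \<open>N\<close> makes \<open>complement_basis\<close>
    applicable and cannot raise the dimension above the one in the hypothesis.\<close>
  define N0 where "N0 = {M \<in> N. \<forall>x. x \<noteq> 0 \<longrightarrow> quad M x \<in> lower (monad_bundle f) x}"
  have sub: "vec.subspace {w. lin_coeffs f w = 0}" by (rule lin_coeffs.subspace_kernel)
  have low: "vec.subspace (lower (monad_bundle f) x)" if "x \<noteq> 0" for x
  proof -
    have "lower (monad_bundle f) x = (\<lambda>w. wedge w x) ` {w. lin_coeffs f w = 0}"
      unfolding lower_monad_bundle[OF that] by blast
    then show ?thesis using wedge_left.subspace_image[OF sub] by simp
  qed
  have N: "vec.subspace N" unfolding N_def by (rule quad_coeffs_right.subspace_kernel)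
  have N0: "vec.subspace N0"
    using N low unfolding N0_def
    by (auto simp: vec.subspace_def quad.zero quad.add quad.scale)
  obtain C where C: "finite C" "C \<subseteq> N" "card C + vec.dim N0 = vec.dim N"
    "N \<subseteq> vec.span (C \<union> N0)" "\<forall>c. (\<Sum>v\<in>C. c v *s v) \<in> N0 \<longrightarrow> (\<forall>v\<in>C. c v = 0)"
    by (rule complement_basis[OF N N0]) (auto simp: N0_def)
  have null: "(\<Sum>M\<in>C. c M *s M) \<in> N0 \<longleftrightarrow> (\<lambda>x. \<Sum>M\<in>C. c M *s quad M x) \<in> null_sections plane (monad_bundle f)" for c
  proof -
    have "(\<Sum>M\<in>C. c M *s M) \<in> N" using C(2) by (intro vec.subspace_sum[OF N] vec.subspace_scale[OF N]) auto
    then show ?thesis by (auto simp: N0_def null_sections_def quad.sum quad.scale)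
  qed
  \<comment> \<open>\<open>dim_mod\<close> counts a set of functions, so distinct elements of
    \<open>C\<close> must give distinct sections.\<close>
  have inj: "inj_on quad C"
  proof (rule inj_onI, rule ccontr)
    fix M M' assume M: "M \<in> C" "M' \<in> C" "quad M = quad M'" "M \<noteq> M'"
    define c :: "_ \<Rightarrow> complex" where "c = (\<lambda>P. if P = M then 1 else if P = M' then -1 else 0)"
    have "(\<Sum>P\<in>C. c P *s quad P x) = (\<Sum>P\<in>{M, M'}. c P *s quad P x)" for x
      using C(1) M by (intro sum.mono_neutral_right) (auto simp: c_def)
    also have "\<dots> x = 0" for x using M by (auto simp: c_def)
    finally have "(\<lambda>x. \<Sum>P\<in>C. c P *s quad P x) \<in> null_sections plane (monad_bundle f)"
      using vec.subspace_0[OF low] by (simp add: null_sections_def)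
    then have "c M = 0" using null C(5) M(1) by blast
    then show False by (simp add: c_def)
  qed
  have "enat s \<le> enat (card (quad ` C))"
  proof -
    have "vec.dim N0 \<le> vec.dim {M. \<forall>x. x \<noteq> 0 \<longrightarrow> quad M x \<in> lower (monad_bundle f) x}"
      by (rule vec.dim_subset) (auto simp: N0_def)
    then show ?thesis using assms C(3) inj by (simp add: card_image N_def)
  qed
  also have "\<dots> \<le> h0 (monad_bundle f) 1"
    unfolding h0_def dim_mod_def
  proof (rule SUP_upper, intro CollectI conjI allI impI)
    show "finite (quad ` C)" using C(1) by simp
    show "quad ` C \<subseteq> sections plane (monad_bundle f) 1" using C(2) quad_section by (auto simp: N_def)
    fix c assume "(\<lambda>x. \<Sum>b\<in>quad ` C. c b *s b x) \<in> null_sections plane (monad_bundle f)"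
    then have "(\<Sum>M\<in>C. c (quad M) *s M) \<in> N0"
      using null[of "\<lambda>M. c (quad M)"] inj by (simp add: sum.reindex)
    then show "\<forall>b\<in>quad ` C. c b = 0" using C(5)[rule_format, of "\<lambda>M. c (quad M)"] by blast
  qed
  finally show ?thesis .
qed

theorem theorem8p13:
  fixes r :: nat
  assumes "even r"
  shows "generically (secant (CARD('n::finite) + r div 2) :: (complex ^ (3 \<times> 'n \<times> 'n)) set)
    (\<lambda>f. monad_surj f \<and> rank_H0 f = enat (2 * CARD('n) + r) \<and>
         moduli_sp r CARD('n) (monad_bundle f) \<longrightarrow>
         h0 (monad_bundle f) 1 \<ge> enat (r div 2))"
  unfolding generically_def
proof (intro exI[of _ "{}"] conjI ballI impI)
  show "zclosed ({} :: (complex ^ (3 \<times> 'n \<times> 'n)) set)"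
    unfolding zclosed_def by (intro exI[of _ "{\<lambda>_. 1}"]) (auto intro: form.const)
  show "secant (CARD('n) + r div 2) \<subseteq>
      zclosure (secant (CARD('n) + r div 2) - {} :: (complex ^ (3 \<times> 'n \<times> 'n)) set)"
    by (simp add: hull_subset)
  fix f :: "complex ^ (3 \<times> 'n \<times> 'n)"
  assume f: "f \<in> secant (CARD('n) + r div 2) - {}"
    and hyp: "monad_surj f \<and> rank_H0 f = enat (2 * CARD('n) + r) \<and> moduli_sp r CARD('n) (monad_bundle f)"
  have sym: "sym_tensor f" and rank: "vec.dim (range (quad_coeffs f)) \<le> 5 * (CARD('n) + r div 2)"
    using secant_rank_le[of f "CARD('n) + r div 2"] f by auto
  define s where "s = r div 2"
  define i where "i = vec.dim {w. lin_coeffs f w = 0}"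
  define m where "m = vec.dim {M. quad_coeffs f M = 0}"
  define m0 where "m0 = vec.dim {M. \<forall>x. x \<noteq> 0 \<longrightarrow> quad M x \<in> lower (monad_bundle f) x}"
  have "2 * CARD('n) + 2 * s \<le> vec.dim (range (lin_coeffs f))"
    using rank_H0_le[of f] hyp assms by (simp add: s_def)
  moreover have "vec.dim (range (lin_coeffs f)) + i = 3 * CARD('n)"
    using rank_nullity[OF lin_coeffs.linear_axioms, of f] by (simp add: i_def)
  moreover have "vec.dim (range (quad_coeffs f)) + m = 9 * CARD('n)"
    using rank_nullity[OF quad_coeffs_right.linear_axioms, of f] by (simp add: m_def)
  moreover have "m0 \<le> 3 * i + CARD('n)"
    unfolding m0_def i_def using dim_null_quad hyp sym by blast
  moreover have "vec.dim (range (quad_coeffs f)) \<le> 5 * CARD('n) + 5 * s"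
    using rank by (simp add: s_def)
  \<comment> \<open>Write n for \<open>CARD('n)\<close>. The first two facts give
    \<open>i \<le> n - 2 * s\<close>, so \<open>m0 + s \<le> 4 * n - 5 * s \<le> m\<close>.\<close>
  ultimately have "m0 + s \<le> m" by linarith
  then show "enat (r div 2) \<le> h0 (monad_bundle f) 1"
    unfolding s_def m_def m0_def by (rule h0_monad_bundle_ge)
qed

end
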